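(* For any partition $\lambda = (\lambda_1, \lambda_2, \ldots, \lambda_\ell)$ of a positive integer $d$, \[ \mathrm{Map}(\lambda) = z(\lambda) \sum_{\mu \vdash d} H^<(\lambda; \mu) \, \mathrm{FSMap}(\mu), \] where $\mathrm{Map}$ and $\mathrm{FSMap}$ are the weighted enumerations of (possibly disconnected) maps and of fully simple maps, and $H^<(\lambda;\mu)$ is the generating series of strictly monotone Hurwitz numbers.
   Context: **Maps.** A map is a finite graph (loops and multiple edges allowed) without isolated vertices, embedded into an oriented compact surface, such that the complement of the graph is a disjoint union of topological disks, called faces. Maps may be disconnected. An oriented edge is an edge with a choice of one of its two orientations; it is adjacent to the face on its left and incident to the vertex it points to. A map carries an ordered tuple $R=(r_1,\dots,r_n)$ of distinct oriented edges (roots), no two adjacent to the same face. Faces adjacent to roots are boundary faces (boundary face $i$ is the one adjacent to $r_i$); the other faces are internal faces. The degree of a face is the number of oriented edges adjacent to it. Two maps are equivalent if there is an orientation-preserving homeomorphism of the underlying surfaces carrying vertices, oriented edges and faces bijectively to vertices, oriented edges and faces, preserving adjacencies and the tuple of roots. Maps are counted up to equivalence. **Permutation model.** Equivalently, a map is encoded by $(\sigma_0,\sigma_1,\sigma_2;R)$, where $\sigma_0,\sigma_1,\sigma_2$ are permutations of a finite set $\mathbb{E}$ (the oriented edges), $\sigma_1$ is a fixed point free involution (swapping the two orientations of an edge), $\sigma_0\sigma_1\sigma_2=\mathrm{id}$ (permutations multiplied right to left), and $R\in\mathbb{E}^n$ is a tuple no two entries of which lie in the same cycle of $\sigma_2$.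 Cycles of $\sigma_0$ are vertices, cycles of $\sigma_1$ are edges, cycles of $\sigma_2$ are faces (length = degree). Two such data are equivalent if there is a bijection $\phi:\mathbb{E}\to\widetilde{\mathbb{E}}$ sending $R$ to $\widetilde R$ (entry by entry) with $\widetilde\sigma_i=\phi\sigma_i\phi^{-1}$ for $i\in\{0,1,2\}$. **Fully simple.** A boundary edge is an oriented edge adjacent to a boundary face. A map is fully simple if each vertex is incident to at most one boundary edge. **Enumerations.** For positive integers $\mu_1,\dots,\mu_n$, $\mathrm{Map}(\mu_1,\dots,\mu_n)$ is the sum, over equivalence classes of maps $M$ with $n$ boundary faces such that boundary face $i$ has degree $\mu_i$ for $i=1,\dots,n$, of the weight \[ \frac{\hbar^{-\chi(M)}}{|\mathrm{Aut}\,M|}\,t_1^{f_1(M)}t_2^{f_2(M)}t_3^{f_3(M)}\cdots . \] Here $\chi(M)$ is the Euler characteristic of the underlying surface with the interiors of the boundary faces removed (number of vertices minus number of edges plus number of internal faces), $f_k(M)$ is the number of internal faces of degree $k$, and $|\mathrm{Aut}\,M|$ is the number of automorphisms, i.e. permutations of the oriented edges arising from an orientation-preserving self-homeomorphism of the surface that preserves the map and the tuple of roots (equivalently, self-equivalences of the data $(\sigma_0,\sigma_1,\sigma_2;R)$). $\mathrm{FSMap}(\mu_1,\dots,\mu_n)$ is the same sum restricted to fully simple maps. Each monomial in $t_1,t_2,\dots$ receives contributions from finitely many maps, so both are formal power series in $t_1,t_2,\ldots$ with coefficients in $\mathbb{Q}[\hbar,\hbar^{-1}]$. **Strictly monotone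 Hurwitz numbers.** A sequence $\tau_1,\dots,\tau_k$ of transpositions in $\mathfrak{S}_d$ is strictly monotone if $\tau_i=(a_i\ b_i)$ with $a_i<b_i$ and $b_1<b_2<\dots<b_k$. For partitions $\lambda,\mu$ of $d$ and $k\ge 0$, $H^<_k(\lambda;\mu)$ is $\frac1{d!}$ times the number of tuples $(\rho_\lambda,\tau_1,\dots,\tau_k,\rho_\mu)$ of permutations in $\mathfrak{S}_d$ such that $\rho_\lambda$ has cycle type $\lambda$, $\rho_\mu$ has cycle type $\mu$, $\tau_1,\dots,\tau_k$ is a strictly monotone sequence of transpositions, and $\rho_\lambda\tau_1\cdots\tau_k\rho_\mu=\mathrm{id}$. Set $H^<(\lambda;\mu)=\sum_{k\ge0}H^<_k(\lambda;\mu)\,\hbar^k$ (a polynomial in $\hbar$). **Notation.** $\mu\vdash d$ means $\mu$ is a partition of $d$; $z(\lambda)=\prod_{i=1}^{\ell(\lambda)}\lambda_i\cdot\prod_{j\ge1}m_j(\lambda)!$, where $\ell(\lambda)$ is the number of parts and $m_j(\lambda)$ is the number of parts equal to $j$. *)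

theory Defs
  imports Complex_Main "HOL-Library.Poly_Mapping" "HOL-Library.Multiset"
    "HOL-Combinatorics.Permutations" "HOL-Combinatorics.Orbits"
begin

section \<open>Cycles of permutations\<close>

definition cycles_on :: "('a \<Rightarrow> 'a) \<Rightarrow> 'a set \<Rightarrow> 'a set set" where
  "cycles_on \<sigma> A = orbit \<sigma> ` A"

definition cycle_type :: "('a \<Rightarrow> 'a) \<Rightarrow> 'a set \<Rightarrow> nat multiset" where
  "cycle_type \<sigma> A = image_mset card (mset_set (cycles_on \<sigma> A))"

section \<open>Maps\<close>

text \<open>
  An element of \<^term>\<open>darts M\<close> is an oriented edge, adjacent to the face on its left and incident
  to the vertex it points to. The permutation \<open>\<sigma>2\<close> goes around faces, \<open>\<sigma>1\<close> reverses
  orientations and \<open>\<sigma>0\<close> goes around vertices. The data encode a graph embedded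
  in a possibly disconnected oriented compact surface.
\<close>

record 'a rmap =
  darts :: "'a set"
  \<sigma>0 :: "'a \<Rightarrow> 'a"
  \<sigma>1 :: "'a \<Rightarrow> 'a"
  \<sigma>2 :: "'a \<Rightarrow> 'a"
  roots :: "'a list"

definition is_map :: "'a rmap \<Rightarrow> bool" where
  "is_map M \<longleftrightarrow>
     finite (darts M) \<and>
     \<sigma>0 M permutes darts M \<and> \<sigma>1 M permutes darts M \<and> \<sigma>2 M permutes darts M \<and>
     (\<forall>e\<in>darts M. \<sigma>1 M e \<noteq> e \<and> \<sigma>1 M (\<sigma>1 M e) = e) \<and>
     \<sigma>0 M \<circ> \<sigma>1 M \<circ> \<sigma>2 M = id \<and>
     set (roots M) \<subseteq> darts M \<and>
     (\<forall>i<length (roots M). \<forall>j<length (roots M). i \<noteq> j \<longrightarrow>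
        orbit (\<sigma>2 M) (roots M ! i) \<noteq> orbit (\<sigma>2 M) (roots M ! j))"

definition vertices :: "'a rmap \<Rightarrow> 'a set set" where
  "vertices M = cycles_on (\<sigma>0 M) (darts M)"

definition edges :: "'a rmap \<Rightarrow> 'a set set" where
  "edges M = cycles_on (\<sigma>1 M) (darts M)"

definition faces :: "'a rmap \<Rightarrow> 'a set set" where
  "faces M = cycles_on (\<sigma>2 M) (darts M)"

definition boundary_faces :: "'a rmap \<Rightarrow> 'a set set" where
  "boundary_faces M = cycles_on (\<sigma>2 M) (set (roots M))"

definition internal_faces :: "'a rmap \<Rightarrow> 'a set set" where
  "internal_faces M = faces M - boundary_faces M"

definition boundary_edges :: "'a rmap \<Rightarrow> 'a set" where
  "boundary_edges M = \<Union> (boundary_faces M)"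

definition boundary_degrees :: "'a rmap \<Rightarrow> nat list" where
  "boundary_degrees M = map (\<lambda>r. card (orbit (\<sigma>2 M) r)) (roots M)"

definition fully_simple :: "'a rmap \<Rightarrow> bool" where
  "fully_simple M \<longleftrightarrow> (\<forall>v\<in>vertices M. card (v \<inter> boundary_edges M) \<le> 1)"

definition euler_char :: "'a rmap \<Rightarrow> int" where
  "euler_char M = int (card (vertices M)) - int (card (edges M)) + int (card (internal_faces M))"

definition face_count :: "'a rmap \<Rightarrow> nat \<Rightarrow> nat" where
  "face_count M k = card {c \<in> internal_faces M. card c = k}"

definition map_iso :: "('a \<Rightarrow> 'b) \<Rightarrow> 'a rmap \<Rightarrow> 'b rmap \<Rightarrow> bool" where
  "map_iso \<phi> M M' \<longleftrightarrow>
     bij_betw \<phi> (darts M) (darts M') \<and>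
     map \<phi> (roots M) = roots M' \<and>
     (\<forall>e\<in>darts M. \<sigma>0 M' (\<phi> e) = \<phi> (\<sigma>0 M e) \<and>
                   \<sigma>1 M' (\<phi> e) = \<phi> (\<sigma>1 M e) \<and>
                   \<sigma>2 M' (\<phi> e) = \<phi> (\<sigma>2 M e))"

text \<open>The condition \<open>permutes\<close> fixes the values of an automorphism outside the darts.\<close>

definition Aut :: "'a rmap \<Rightarrow> ('a \<Rightarrow> 'a) set" where
  "Aut M = {\<phi>. \<phi> permutes darts M \<and> map_iso \<phi> M M}"

definition map_equiv :: "('a rmap \<times> 'a rmap) set" where
  "map_equiv = {(M, M'). is_map M \<and> is_map M' \<and> (\<exists>\<phi>. map_iso \<phi> M M')}"

section \<open>Weighted enumerations\<close>

text \<open>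
  The Laurent polynomial ring \<open>\<rat>[\<hbar>, \<hbar>\<inverse>]\<close> is the type \<open>int \<Rightarrow>\<^sub>0 rat\<close>, with its convolution
  product; \<open>Poly_Mapping.single j c\<close> is \<open>c \<hbar>\<^sup>j\<close>. A formal power series in
  \<open>t\<^sub>1, t\<^sub>2, \<dots>\<close> is the family of its coefficients, indexed by the
  finitely supported exponent vectors; \<^term>\<open>Poly_Mapping.lookup e k\<close> is the exponent of \<open>t\<^sub>k\<close>. No face has
  degree 0, so the exponent of the superfluous variable \<open>t\<^sub>0\<close> is 0 in each weight.
\<close>

type_synonym laurent = "int \<Rightarrow>\<^sub>0 rat"
type_synonym t_series = "(nat \<Rightarrow>\<^sub>0 nat) \<Rightarrow> laurent"

definition map_weight :: "'a rmap \<Rightarrow> t_series" where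
  "map_weight M = (\<lambda>e. if \<forall>k. Poly_Mapping.lookup e k = face_count M k
     then Poly_Mapping.single (- euler_char M) (1 / of_nat (card (Aut M))) else 0)"

text \<open>
  Every finite set of darts is in bijection with a set of natural numbers, so every equivalence
  class of maps is represented by a map with darts in \<^typ>\<open>nat\<close>.
  The sum of the weights is taken coefficientwise, each coefficient being a finite sum
  (see \<open>finite_nonzero_weights\<close> below).
\<close>

definition class_weight :: "nat rmap set \<Rightarrow> t_series" where
  "class_weight C = map_weight (SOME M. M \<in> C)"

definition weight_sum :: "nat rmap set \<Rightarrow> t_series" where
  "weight_sum A = (\<lambda>e. \<Sum>C | C \<in> A // map_equiv \<and> class_weight C e \<noteq> 0. class_weight C e)"

definition maps_with :: "nat list \<Rightarrow> nat rmap set" where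
  "maps_with \<mu> = {M. is_map M \<and> boundary_degrees M = \<mu>}"

definition Map_series :: "nat list \<Rightarrow> t_series" where
  "Map_series \<mu> = weight_sum (maps_with \<mu>)"

definition FSMap_series :: "nat list \<Rightarrow> t_series" where
  "FSMap_series \<mu> = weight_sum {M \<in> maps_with \<mu>. fully_simple M}"

section \<open>Partitions and strictly monotone Hurwitz numbers\<close>

definition partition_of :: "nat \<Rightarrow> nat list \<Rightarrow> bool" where
  "partition_of d \<mu> \<longleftrightarrow> sorted_wrt (\<ge>) \<mu> \<and> (\<forall>p\<in>set \<mu>. p > 0) \<and> sum_list \<mu> = d"

definition z_partition :: "nat list \<Rightarrow> nat" where
  "z_partition \<mu> = prod_list \<mu> * (\<Prod>j\<in>set \<mu>. fact (count_list \<mu> j))"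

definition strictly_monotone :: "nat \<Rightarrow> (nat \<Rightarrow> nat) list \<Rightarrow> bool" where
  "strictly_monotone d \<tau>s \<longleftrightarrow>
     (\<exists>ps. \<tau>s = map (\<lambda>(a, b). transpose a b) ps \<and>
           (\<forall>(a, b)\<in>set ps. 1 \<le> a \<and> a < b \<and> b \<le> d) \<and>
           sorted_wrt (<) (map snd ps))"

definition hurwitz_tuples ::
  "nat \<Rightarrow> nat \<Rightarrow> nat list \<Rightarrow> nat list \<Rightarrow> ((nat \<Rightarrow> nat) \<times> (nat \<Rightarrow> nat) list \<times> (nat \<Rightarrow> nat)) set" where
  "hurwitz_tuples d k \<nu> \<mu> = {(\<rho>, \<tau>s, \<rho>').
     \<rho> permutes {1..d} \<and> cycle_type \<rho> {1..d} = mset \<nu> \<and>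
     \<rho>' permutes {1..d} \<and> cycle_type \<rho>' {1..d} = mset \<mu> \<and>
     length \<tau>s = k \<and> strictly_monotone d \<tau>s \<and>
     \<rho> \<circ> foldr (\<circ>) \<tau>s id \<circ> \<rho>' = id}"

definition hurwitz_number :: "nat \<Rightarrow> nat \<Rightarrow> nat list \<Rightarrow> nat list \<Rightarrow> rat" where
  "hurwitz_number d k \<nu> \<mu> = of_nat (card (hurwitz_tuples d k \<nu> \<mu>)) / fact d"

text \<open>
  \<^const>\<open>Sum_any\<close> is the sum over all \<open>k\<close> of a finitely supported family
  (see \<open>finite_hurwitz_support\<close> below).
\<close>

definition hurwitz_series :: "nat \<Rightarrow> nat list \<Rightarrow> nat list \<Rightarrow> laurent" where
  "hurwitz_series d \<nu> \<mu> =
     Sum_any (\<lambda>k. Poly_Mapping.single (int k) (hurwitz_number d k \<nu> \<mu>))"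

section \<open>Well-definedness\<close>

lemma is_map_permutation:
  assumes "is_map M"
  shows "permutation (\<sigma>0 M)" "permutation (\<sigma>1 M)" "permutation (\<sigma>2 M)"
  using assms by (auto simp: is_map_def permutation_permutes)

lemma map_iso_id: "map_iso id M M"
  by (simp add: map_iso_def)

lemma map_iso_comp:
  assumes "map_iso \<phi> M M'" "map_iso \<psi> M' M''"
  shows "map_iso (\<psi> \<circ> \<phi>) M M''"
proof -
  have "bij_betw (\<psi> \<circ> \<phi>) (darts M) (darts M'')"
    using assms(1,2) unfolding map_iso_def by (blast intro: bij_betw_trans)
  moreover have "map (\<psi> \<circ> \<phi>) (roots M) = map \<psi> (map \<phi> (roots M))"
    by (simp only: map_map)
  then have "map (\<psi> \<circ> \<phi>) (roots M) = roots M''"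
    using assms(1,2) by (simp only: map_iso_def)
  moreover have "\<phi> e \<in> darts M'" if "e \<in> darts M" for e
    using assms(1) that bij_betw_apply by (fastforce simp: map_iso_def)
  ultimately show ?thesis
    using assms(1,2) by (simp add: map_iso_def)
qed

lemma map_iso_inv:
  assumes iso: "map_iso \<phi> M M'" and M: "is_map M"
  shows "map_iso (inv_into (darts M) \<phi>) M' M"
proof -
  let ?\<psi> = "inv_into (darts M) \<phi>"
  have bij: "bij_betw \<phi> (darts M) (darts M')" using iso by (simp add: map_iso_def)
  have left: "?\<psi> (\<phi> x) = x" if "x \<in> darts M" for x
    using bij that by (rule bij_betw_inv_into_left)
  have perm: "\<sigma>0 M x \<in> darts M" "\<sigma>1 M x \<in> darts M" "\<sigma>2 M x \<in> darts M" if "x \<in> darts M" for x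
    using M that by (simp_all add: is_map_def permutes_in_image)
  have "map ?\<psi> (roots M') = roots M"
  proof -
    have "roots M' = map \<phi> (roots M)" using iso by (simp add: map_iso_def)
    moreover have "?\<psi> (\<phi> x) = x" if "x \<in> set (roots M)" for x
      by (rule left) (use M that in \<open>auto simp: is_map_def\<close>)
    ultimately show ?thesis by (simp add: map_idI)
  qed
  moreover have "\<sigma>0 M (?\<psi> y) = ?\<psi> (\<sigma>0 M' y) \<and> \<sigma>1 M (?\<psi> y) = ?\<psi> (\<sigma>1 M' y) \<and>
      \<sigma>2 M (?\<psi> y) = ?\<psi> (\<sigma>2 M' y)" if "y \<in> darts M'" for y
  proof -
    have "y \<in> \<phi> ` darts M" using bij that by (simp add: bij_betw_def)
    then obtain x where x: "x \<in> darts M" "y = \<phi> x" by blast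
    have "\<sigma>0 M' y = \<phi> (\<sigma>0 M x)" "\<sigma>1 M' y = \<phi> (\<sigma>1 M x)" "\<sigma>2 M' y = \<phi> (\<sigma>2 M x)"
      using iso x by (simp_all add: map_iso_def)
    then show ?thesis using x by (simp add: left perm)
  qed
  ultimately show ?thesis
    using bij_betw_inv_into[OF bij] by (simp add: map_iso_def)
qed

lemma equiv_map_equiv: "equiv {M :: 'a rmap. is_map M} map_equiv"
proof (rule equivI)
  show "map_equiv \<subseteq> {M :: 'a rmap. is_map M} \<times> {M. is_map M}"
    by (auto simp: map_equiv_def)
  show "refl_on {M :: 'a rmap. is_map M} map_equiv"
    unfolding refl_on_def map_equiv_def using map_iso_id by blast
  show "sym (map_equiv :: ('a rmap \<times> 'a rmap) set)"
  proof (rule symI)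
    fix M M' :: "'a rmap" assume "(M, M') \<in> map_equiv"
    then obtain \<phi> where "is_map M" "is_map M'" "map_iso \<phi> M M'"
      by (auto simp: map_equiv_def)
    with map_iso_inv[of \<phi> M M'] show "(M', M) \<in> map_equiv"
      unfolding map_equiv_def by blast
  qed
  show "trans (map_equiv :: ('a rmap \<times> 'a rmap) set)"
  proof (rule transI)
    fix M M' M'' :: "'a rmap" assume "(M, M') \<in> map_equiv" "(M', M'') \<in> map_equiv"
    then obtain \<phi> \<psi> where "is_map M" "is_map M''" "map_iso \<phi> M M'" "map_iso \<psi> M' M''"
      by (auto simp: map_equiv_def)
    with map_iso_comp[of \<phi> M M' \<psi> M''] show "(M, M'') \<in> map_equiv"
      unfolding map_equiv_def by blast
  qed
qed

lemma orbit_intertwine: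
  assumes f: "f permutes A" and "x \<in> A" and c: "\<And>y. y \<in> A \<Longrightarrow> g (\<phi> y) = \<phi> (f y)"
  shows "orbit g (\<phi> x) = \<phi> ` orbit f x"
proof -
  have A: "(f ^^ n) x \<in> A" for n
    by (induction n) (use \<open>x \<in> A\<close> f in \<open>auto simp: permutes_in_image\<close>)
  have "(g ^^ n) (\<phi> x) = \<phi> ((f ^^ n) x)" for n
    by (induction n) (simp_all add: c A)
  then show ?thesis by (auto simp: orbit_altdef)
qed

lemma cycles_on_intertwine:
  assumes "f permutes A" "S \<subseteq> A" "\<And>y. y \<in> A \<Longrightarrow> g (\<phi> y) = \<phi> (f y)"
  shows "cycles_on g (\<phi> ` S) = image \<phi> ` cycles_on f S"
proof -
  have "orbit g (\<phi> x) = \<phi> ` orbit f x" if "x \<in> S" for x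
    by (rule orbit_intertwine[where A = A]) (use assms that in auto)
  then show ?thesis by (simp add: cycles_on_def image_image)
qed

lemma cycles_on_subset:
  assumes "f permutes A" "S \<subseteq> A" "c \<in> cycles_on f S"
  shows "c \<subseteq> A"
  using assms permutes_orbit_subset by (fastforce simp: cycles_on_def)

lemma map_iso_invariants:
  assumes iso: "map_iso \<phi> M M'" and M: "is_map M"
  shows "boundary_degrees M' = boundary_degrees M"
    and "fully_simple M' \<longleftrightarrow> fully_simple M"
    and "euler_char M' = euler_char M"
    and "face_count M' = face_count M"
proof -
  let ?D = "darts M"
  have inj: "inj_on \<phi> ?D" and D': "darts M' = \<phi> ` ?D"
    using iso by (auto simp: map_iso_def bij_betw_def)
  have R: "set (roots M) \<subseteq> ?D" and R': "roots M' = map \<phi> (roots M)"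
    using iso M by (auto simp: map_iso_def is_map_def)
  have p: "\<sigma>0 M permutes ?D" "\<sigma>1 M permutes ?D" "\<sigma>2 M permutes ?D"
    using M by (auto simp: is_map_def)
  have c: "\<And>y. y \<in> ?D \<Longrightarrow> \<sigma>0 M' (\<phi> y) = \<phi> (\<sigma>0 M y)"
    "\<And>y. y \<in> ?D \<Longrightarrow> \<sigma>1 M' (\<phi> y) = \<phi> (\<sigma>1 M y)"
    "\<And>y. y \<in> ?D \<Longrightarrow> \<sigma>2 M' (\<phi> y) = \<phi> (\<sigma>2 M y)"
    using iso by (auto simp: map_iso_def)
  have V: "vertices M' = image \<phi> ` vertices M" and E: "edges M' = image \<phi> ` edges M"
    and F: "faces M' = image \<phi> ` faces M"
    and B: "boundary_faces M' = image \<phi> ` boundary_faces M"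
    using cycles_on_intertwine[where \<phi> = \<phi> and g = "\<sigma>0 M'", OF p(1) order_refl c(1)]
      cycles_on_intertwine[where \<phi> = \<phi> and g = "\<sigma>1 M'", OF p(2) order_refl c(2)]
      cycles_on_intertwine[where \<phi> = \<phi> and g = "\<sigma>2 M'", OF p(3) order_refl c(3)]
      cycles_on_intertwine[where \<phi> = \<phi> and g = "\<sigma>2 M'", OF p(3) R c(3)]
    by (simp_all add: vertices_def edges_def faces_def boundary_faces_def D' R')
  have sub: "vertices M \<subseteq> Pow ?D" "edges M \<subseteq> Pow ?D" "faces M \<subseteq> Pow ?D"
    "boundary_faces M \<subseteq> Pow ?D"
    using cycles_on_subset[OF p(1) order_refl] cycles_on_subset[OF p(2) order_refl]
      cycles_on_subset[OF p(3) order_refl] cycles_on_subset[OF p(3) R]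
    unfolding vertices_def edges_def faces_def boundary_faces_def by blast+
  have injP: "inj_on (image \<phi>) (Pow ?D)"
    using inj by (rule inj_on_image_Pow)
  have cardS: "card (image \<phi> ` S) = card S" if "S \<subseteq> Pow ?D" for S
    using inj_on_subset[OF injP that] by (rule card_image)
  have I: "internal_faces M' = image \<phi> ` internal_faces M"
    unfolding internal_faces_def F B
    by (rule inj_on_image_set_diff[OF injP, symmetric]) (use sub in auto)
  have subI: "internal_faces M \<subseteq> Pow ?D"
    using sub by (auto simp: internal_faces_def)
  have card1: "card (\<phi> ` S) = card S" if "S \<subseteq> ?D" for S
    using inj_on_subset[OF inj that] by (rule card_image)
  show "euler_char M' = euler_char M"
    by (simp add: euler_char_def V E I cardS sub subI)
  have "{c \<in> internal_faces M'. card c = k} = image \<phi> ` {c \<in> internal_faces M. card c = k}" for k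
    using subI by (auto simp: I card1 subset_iff)
  moreover have "{c \<in> internal_faces M. card c = k} \<subseteq> Pow ?D" for k
    using subI by auto
  ultimately show "face_count M' = face_count M"
    by (simp add: face_count_def cardS fun_eq_iff)
  have "orbit (\<sigma>2 M') (\<phi> r) = \<phi> ` orbit (\<sigma>2 M) r" if "r \<in> set (roots M)" for r
    by (rule orbit_intertwine[where A = ?D]) (use p c R that in auto)
  moreover have "orbit (\<sigma>2 M) r \<subseteq> ?D" if "r \<in> set (roots M)" for r
    using permutes_orbit_subset[OF p(3)] R that by blast
  ultimately show "boundary_degrees M' = boundary_degrees M"
    by (simp add: boundary_degrees_def R' card1)
  have be: "boundary_edges M' = \<phi> ` boundary_edges M" "boundary_edges M \<subseteq> ?D"
    using sub by (auto simp: boundary_edges_def B)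
  have "card (\<phi> ` v \<inter> boundary_edges M') = card (v \<inter> boundary_edges M)" if "v \<in> vertices M" for v
  proof -
    have v: "v \<subseteq> ?D" using that sub by auto
    then have "\<phi> ` v \<inter> boundary_edges M' = \<phi> ` (v \<inter> boundary_edges M)"
      using inj_on_image_Int[OF inj v be(2)] be(1) by simp
    then show ?thesis using v by (simp add: card1 le_infI1)
  qed
  then show "fully_simple M' \<longleftrightarrow> fully_simple M"
    by (simp add: fully_simple_def V)
qed

lemma Aut_card_le:
  assumes iso: "map_iso \<phi> M M'" and M: "is_map M" and M': "is_map M'"
  shows "card (Aut M) \<le> card (Aut M')"
proof (rule card_inj_on_le)
  let ?D = "darts M" and ?D' = "darts M'"
  let ?\<psi> = "inv_into ?D \<phi>"
  let ?F = "\<lambda>\<alpha> y. if y \<in> ?D' then \<phi> (\<alpha> (?\<psi> y)) else y"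
  have bij: "bij_betw \<phi> ?D ?D'" using iso by (simp add: map_iso_def)
  have left: "?\<psi> (\<phi> x) = x" if "x \<in> ?D" for x
    using bij that by (simp add: bij_betw_inv_into_left)
  show "inj_on ?F (Aut M)"
  proof (rule inj_onI)
    fix \<alpha> \<beta> assume \<alpha>\<beta>: "\<alpha> \<in> Aut M" "\<beta> \<in> Aut M" and eq: "?F \<alpha> = ?F \<beta>"
    have "\<alpha> x = \<beta> x" for x
    proof (cases "x \<in> ?D")
      case True
      then have "\<phi> x \<in> ?D'" using bij by (auto simp: bij_betw_def)
      then have "\<phi> (\<alpha> x) = \<phi> (\<beta> x)" using fun_cong[OF eq, of "\<phi> x"] left True by simp
      moreover have "\<alpha> x \<in> ?D" "\<beta> x \<in> ?D"
        using \<alpha>\<beta> True by (auto simp: Aut_def permutes_in_image)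
      ultimately show ?thesis using bij by (auto simp: bij_betw_def inj_on_def)
    next
      case False
      then show ?thesis using \<alpha>\<beta> by (auto simp: Aut_def permutes_not_in)
    qed
    then show "\<alpha> = \<beta>" by auto
  qed
  show "?F ` Aut M \<subseteq> Aut M'"
  proof safe
    fix \<alpha> assume \<alpha>: "\<alpha> \<in> Aut M"
    have "map_iso (\<phi> \<circ> (\<alpha> \<circ> ?\<psi>)) M' M'"
      using map_iso_comp[OF map_iso_comp[OF map_iso_inv[OF iso M]] iso, of \<alpha>] \<alpha>
      by (simp add: Aut_def)
    moreover have "bij_betw (?F \<alpha>) ?D' ?D' = bij_betw (\<phi> \<circ> (\<alpha> \<circ> ?\<psi>)) ?D' ?D'"
      by (rule bij_betw_cong) simp
    moreover have "map (?F \<alpha>) (roots M') = map (\<phi> \<circ> (\<alpha> \<circ> ?\<psi>)) (roots M')"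
      using M' by (auto simp: is_map_def)
    moreover have "\<sigma>0 M' y \<in> ?D'" "\<sigma>1 M' y \<in> ?D'" "\<sigma>2 M' y \<in> ?D'" if "y \<in> ?D'" for y
      using M' that by (auto simp: is_map_def permutes_in_image)
    ultimately have "map_iso (?F \<alpha>) M' M'"
      unfolding map_iso_def by simp
    moreover from this have "?F \<alpha> permutes ?D'"
      by (intro bij_imp_permutes) (auto simp: map_iso_def)
    ultimately show "?F \<alpha> \<in> Aut M'" by (simp add: Aut_def)
  qed
  have "finite {p. p permutes ?D'}"
    using M' by (simp add: is_map_def finite_permutations)
  then show "finite (Aut M')"
    by (rule rev_finite_subset) (auto simp: Aut_def)
qed

lemma map_weight_iso:
  assumes "map_iso \<phi> M M'" "is_map M" "is_map M'"
  shows "map_weight M' = map_weight M"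
  using map_iso_invariants[OF assms(1,2)] Aut_card_le[OF assms]
    Aut_card_le[OF map_iso_inv[OF assms(1,2)] assms(3,2)]
  by (simp add: map_weight_def cong: if_cong)

lemma class_weight_eq:
  assumes "C \<in> A // map_equiv" "M \<in> C"
  shows "class_weight C = map_weight M"
proof -
  obtain N where N: "C = map_equiv `` {N}" using assms(1) by (rule quotientE)
  have *: "map_weight M' = map_weight N" if "M' \<in> C" for M'
    using that map_weight_iso unfolding N by (auto simp: map_equiv_def)
  have "(SOME M. M \<in> C) \<in> C"
    using assms(2) by (rule someI)
  then show ?thesis
    using *[OF assms(2)] * by (simp only: class_weight_def)
qed

lemma card_darts:
  assumes M: "is_map M"
  shows "card (darts M) = sum_list (boundary_degrees M) + (\<Sum>c\<in>internal_faces M. card c)"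
proof -
  have p: "\<sigma>2 M permutes darts M" and fin: "finite (darts M)"
    and R: "set (roots M) \<subseteq> darts M"
    using M by (auto simp: is_map_def)
  have perm: "permutation (\<sigma>2 M)" using is_map_permutation[OF M] by simp
  have sub: "c \<subseteq> darts M" if "c \<in> faces M" for c
    using cycles_on_subset[OF p order_refl] that by (simp add: faces_def)
  have finF: "finite (faces M)" using fin by (simp add: faces_def cycles_on_def)
  have U: "\<Union> (faces M) = darts M"
  proof
    show "\<Union> (faces M) \<subseteq> darts M" using sub by blast
    show "darts M \<subseteq> \<Union> (faces M)"
    proof
      fix x assume "x \<in> darts M"
      then have "orbit (\<sigma>2 M) x \<in> faces M" by (simp add: faces_def cycles_on_def)
      moreover have "x \<in> orbit (\<sigma>2 M) x" using perm by (rule permutation_self_in_orbit)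
      ultimately show "x \<in> \<Union> (faces M)" by blast
    qed
  qed
  have disj: "c \<inter> c' = {}" if "c \<in> faces M" "c' \<in> faces M" "c \<noteq> c'" for c c'
  proof (rule ccontr)
    assume "c \<inter> c' \<noteq> {}"
    then obtain y where y: "y \<in> c" "y \<in> c'" by auto
    have "orbit (\<sigma>2 M) y = c" if c: "c \<in> faces M" "y \<in> c" for c
    proof -
      obtain x where x: "c = orbit (\<sigma>2 M) x" using c by (auto simp: faces_def cycles_on_def)
      have "cyclic_on (\<sigma>2 M) c" unfolding x using p fin by (rule cyclic_on_orbit)
      then show ?thesis using c(2) by (rule orbit_cyclic_eq3)
    qed
    then show False using that y by blast
  qed
  have "card (darts M) = (\<Sum>c\<in>faces M. card c)"
  proof -
    have "card (\<Union> (faces M)) = (\<Sum>c\<in>faces M. card c)"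
    proof (rule card_Union_disjoint)
      show "pairwise disjnt (faces M)" using disj by (simp add: pairwise_def disjnt_def)
      show "finite c" if "c \<in> faces M" for c using sub[OF that] fin by (rule finite_subset)
    qed
    then show ?thesis by (simp only: U)
  qed
  also have "faces M = boundary_faces M \<union> internal_faces M"
  proof -
    have "boundary_faces M \<subseteq> faces M"
      using R by (simp add: faces_def boundary_faces_def cycles_on_def image_mono)
    then show ?thesis unfolding internal_faces_def by blast
  qed
  also have "(\<Sum>c\<in>boundary_faces M \<union> internal_faces M. card c) =
      (\<Sum>c\<in>boundary_faces M. card c) + (\<Sum>c\<in>internal_faces M. card c)"
    using finF by (intro sum.union_disjoint) (auto simp: internal_faces_def boundary_faces_def cycles_on_def)
  also have "(\<Sum>c\<in>boundary_faces M. card c) = sum_list (boundary_degrees M)"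
  proof -
    have "distinct (map (orbit (\<sigma>2 M)) (roots M))"
      using M by (simp add: is_map_def distinct_conv_nth)
    from sum_list_distinct_conv_sum_set[OF this, of card] show ?thesis
      by (simp add: boundary_degrees_def boundary_faces_def cycles_on_def o_def)
  qed
  finally show ?thesis .
qed

lemma finite_maps_on: "finite {M :: 'a rmap. is_map M \<and> darts M = D \<and> length (roots M) = n}"
proof (cases "finite D")
  case True
  let ?P = "{p. p permutes D}"
  let ?L = "{xs. set xs \<subseteq> D \<and> length xs = n}"
  have "finite ((\<lambda>(a, b, c, r). \<lparr>darts = D, \<sigma>0 = a, \<sigma>1 = b, \<sigma>2 = c, roots = r\<rparr>) ` (?P \<times> ?P \<times> ?P \<times> ?L))"
    using True by (intro finite_imageI finite_cartesian_product finite_permutations finite_lists_length_eq)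
  then show ?thesis
  proof (rule rev_finite_subset, safe)
    fix M :: "'a rmap" assume "is_map M"
    then show "M \<in> (\<lambda>(a, b, c, r). \<lparr>darts = darts M, \<sigma>0 = a, \<sigma>1 = b, \<sigma>2 = c, roots = r\<rparr>) `
      ({p. p permutes darts M} \<times> {p. p permutes darts M} \<times> {p. p permutes darts M} \<times>
       {xs. set xs \<subseteq> darts M \<and> length xs = length (roots M)})"
      by (intro image_eqI[of _ _ "(\<sigma>0 M, \<sigma>1 M, \<sigma>2 M, roots M)"]) (auto simp: is_map_def)
  qed
next
  case False
  then have "\<not> (is_map M \<and> darts M = D)" for M :: "'a rmap"
    by (auto simp: is_map_def)
  then have "{M :: 'a rmap. is_map M \<and> darts M = D \<and> length (roots M) = n} = {}"
    by blast
  then show ?thesis by (simp only: finite.emptyI)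
qed

lemma ex_transport:
  fixes M :: "'a rmap" and D' :: "'b set"
  assumes M: "is_map M" and bij: "bij_betw \<phi> (darts M) D'"
  shows "\<exists>M'. is_map M' \<and> darts M' = D' \<and> map_iso \<phi> M M'"
proof -
  let ?D = "darts M"
  let ?\<psi> = "inv_into ?D \<phi>"
  define T where "T f y = (if y \<in> D' then \<phi> (f (?\<psi> y)) else y)" for f y
  have left: "?\<psi> (\<phi> x) = x" if "x \<in> ?D" for x
    using bij that by (simp add: bij_betw_inv_into_left)
  have D': "D' = \<phi> ` ?D" and inj: "inj_on \<phi> ?D" using bij by (auto simp: bij_betw_def)
  have T: "T f (\<phi> x) = \<phi> (f x)" if "x \<in> ?D" for f x
    using that left by (simp add: T_def D')
  have Tp: "T f permutes D'" if f: "f permutes ?D" for f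
  proof (rule bij_imp_permutes)
    have "bij_betw (\<phi> \<circ> (f \<circ> ?\<psi>)) D' D'"
      using bij_betw_inv_into[OF bij] permutes_imp_bij[OF f] bij by (blast intro: bij_betw_trans)
    then show "bij_betw (T f) D' D'" by (rule bij_betw_cong[THEN iffD1, rotated]) (simp add: T_def)
  qed (simp add: T_def)
  define M' where "M' = \<lparr>darts = D', \<sigma>0 = T (\<sigma>0 M), \<sigma>1 = T (\<sigma>1 M), \<sigma>2 = T (\<sigma>2 M),
    roots = map \<phi> (roots M)\<rparr>"
  have p: "\<sigma>0 M permutes ?D" "\<sigma>1 M permutes ?D" "\<sigma>2 M permutes ?D"
    and R: "set (roots M) \<subseteq> ?D"
    using M by (auto simp: is_map_def)
  have iso: "map_iso \<phi> M M'" using bij by (simp add: map_iso_def M'_def T)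
  have in_D: "\<sigma>0 M x \<in> ?D" "\<sigma>1 M x \<in> ?D" "\<sigma>2 M x \<in> ?D" if "x \<in> ?D" for x
    using p that by (auto simp: permutes_in_image)
  have inv: "T (\<sigma>1 M) y \<noteq> y \<and> T (\<sigma>1 M) (T (\<sigma>1 M) y) = y" if "y \<in> D'" for y
  proof -
    obtain x where x: "x \<in> ?D" "y = \<phi> x" using \<open>y \<in> D'\<close> D' by blast
    then show ?thesis using M in_D inj by (auto simp: T is_map_def inj_on_def)
  qed
  have comp: "T (\<sigma>0 M) \<circ> T (\<sigma>1 M) \<circ> T (\<sigma>2 M) = id"
  proof
    fix y
    have *: "\<sigma>0 M (\<sigma>1 M (\<sigma>2 M x)) = x" for x
      using M by (metis comp_apply id_apply is_map_def)
    show "(T (\<sigma>0 M) \<circ> T (\<sigma>1 M) \<circ> T (\<sigma>2 M)) y = id y"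
    proof (cases "y \<in> D'")
      case True
      then obtain x where x: "x \<in> ?D" "y = \<phi> x" using D' by auto
      then show ?thesis using in_D * by (simp add: T)
    qed (simp add: T_def)
  qed
  have rts: "orbit (T (\<sigma>2 M)) (\<phi> (roots M ! i)) \<noteq> orbit (T (\<sigma>2 M)) (\<phi> (roots M ! j))"
    if ij: "i < length (roots M)" "j < length (roots M)" "i \<noteq> j" for i j
  proof -
    have D: "roots M ! i \<in> ?D" "roots M ! j \<in> ?D" using R ij by (meson nth_mem subsetD)+
    have "orbit (\<sigma>2 M) (roots M ! i) \<noteq> orbit (\<sigma>2 M) (roots M ! j)"
      using M ij by (simp add: is_map_def)
    moreover have "orbit (T (\<sigma>2 M)) (\<phi> x) = \<phi> ` orbit (\<sigma>2 M) x" if "x \<in> ?D" for x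
      by (rule orbit_intertwine[where A = ?D]) (use p T that in auto)
    ultimately show ?thesis
      using D permutes_orbit_subset[OF p(3)] inj_on_image_eq_iff[OF inj] by metis
  qed
  have "finite D'" using M D' by (auto simp: is_map_def)
  then have "is_map M'"
    using Tp[OF p(1)] Tp[OF p(2)] Tp[OF p(3)] inv comp image_mono[OF R, of \<phi>] rts
    by (simp add: is_map_def M'_def D'[symmetric])
  then show ?thesis using iso by (auto simp: M'_def)
qed

lemma finite_nonzero_weights:
  assumes "A \<subseteq> maps_with \<mu>"
  shows "finite {C \<in> A // map_equiv. class_weight C e \<noteq> 0}"
proof -
  define N where "N = sum_list \<mu> + (\<Sum>k\<in>Poly_Mapping.keys e. k * Poly_Mapping.lookup e k)"
  let ?S = "{M :: nat rmap. is_map M \<and> darts M = {..<N} \<and> length (roots M) = length \<mu>}"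
  have "{C \<in> A // map_equiv. class_weight C e \<noteq> 0} \<subseteq> (\<lambda>M. map_equiv `` {M}) ` ?S"
  proof safe
    fix C assume C: "C \<in> A // map_equiv" and nz: "class_weight C e \<noteq> 0"
    obtain M where M: "M \<in> A" "C = map_equiv `` {M}" using C by (rule quotientE)
    then have isM: "is_map M" and bd: "boundary_degrees M = \<mu>"
      using assms by (auto simp: maps_with_def)
    have "M \<in> C" using isM map_iso_id unfolding M(2) map_equiv_def by blast
    then have "map_weight M e \<noteq> 0" using class_weight_eq[OF C] nz by simp
    then have fc: "Poly_Mapping.lookup e k = face_count M k" for k
      by (auto simp: map_weight_def split: if_splits)
    have fin: "finite (internal_faces M)"
      using isM by (auto simp: internal_faces_def faces_def cycles_on_def is_map_def)
    have "(\<Sum>c\<in>internal_faces M. card c) =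
        (\<Sum>k\<in>card ` internal_faces M. \<Sum>c | c \<in> internal_faces M \<and> card c = k. card c)"
      using fin by (rule sum.image_gen)
    also have "\<dots> = (\<Sum>k\<in>card ` internal_faces M. k * face_count M k)"
      by (intro sum.cong refl) (simp add: face_count_def)
    also have "\<dots> = (\<Sum>k\<in>Poly_Mapping.keys e. k * Poly_Mapping.lookup e k)"
    proof (rule sum.mono_neutral_cong_left[symmetric])
      show "Poly_Mapping.keys e \<subseteq> card ` internal_faces M"
      proof
        fix k assume "k \<in> Poly_Mapping.keys e"
        then have "face_count M k \<noteq> 0" using fc by (simp add: in_keys_iff)
        then have "{c \<in> internal_faces M. card c = k} \<noteq> {}"
          unfolding face_count_def by (metis card.empty)
        then show "k \<in> card ` internal_faces M" by auto
      qed
    qed (use fin fc in \<open>auto simp: in_keys_iff\<close>)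
    finally have card: "card (darts M) = N"
      using card_darts[OF isM] bd by (simp add: N_def)
    moreover have "finite (darts M)" using isM by (simp add: is_map_def)
    ultimately obtain \<phi> where "bij_betw \<phi> (darts M) {..<N}"
      using finite_same_card_bij[of "darts M" "{..<N}"] by auto
    then obtain M' where M': "is_map M'" "darts M' = {..<N}" "map_iso \<phi> M M'"
      using ex_transport[OF isM] by blast
    have "roots M' = map \<phi> (roots M)" using M'(3) by (simp add: map_iso_def)
    then have "length (roots M') = length \<mu>"
      using bd by (auto simp: boundary_degrees_def)
    moreover have "(M, M') \<in> map_equiv" using isM M' by (auto simp: map_equiv_def)
    then have "C = map_equiv `` {M'}"
      unfolding M(2) by (rule equiv_class_eq[OF equiv_map_equiv])
    moreover have "M' \<in> ?S" using M' calculation(1) by blast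
    ultimately show "C \<in> (\<lambda>M. map_equiv `` {M}) ` ?S" by blast
  qed
  then show ?thesis by (rule finite_subset) (intro finite_imageI finite_maps_on)
qed

lemma finite_partitions: "finite {\<mu>. partition_of d \<mu>}"
proof -
  have len: "length \<mu> \<le> sum_list \<mu>" if "\<forall>p\<in>set \<mu>. p > 0" for \<mu> :: "nat list"
    using that by (induction \<mu>) auto
  have "{\<mu>. partition_of d \<mu>} \<subseteq> {\<mu>. set \<mu> \<subseteq> {..d} \<and> length \<mu> \<le> d}"
    using len member_le_sum_list by (fastforce simp: partition_of_def)
  then show ?thesis by (rule finite_subset) (simp add: finite_lists_length_le)
qed

lemma strictly_monotone_length:
  assumes "strictly_monotone d \<tau>s"
  shows "length \<tau>s \<le> d"
proof -
  obtain ps where ps: "\<tau>s = map (\<lambda>(a, b). transpose a b) ps"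
    "\<forall>(a, b)\<in>set ps. 1 \<le> a \<and> a < b \<and> b \<le> d" "sorted_wrt (<) (map snd ps)"
    using assms by (auto simp: strictly_monotone_def)
  have "distinct (map snd ps)" using ps(3) by (simp add: strict_sorted_iff)
  then have "length ps = card (set (map snd ps))" by (metis distinct_card length_map)
  also have "\<dots> \<le> card {1..d}"
    by (rule card_mono) (use ps(2) in force)+
  finally show ?thesis using ps(1) by simp
qed

lemma finite_hurwitz_tuples: "finite (hurwitz_tuples d k \<nu> \<mu>)"
proof -
  let ?P = "{p. p permutes {1..d}}"
  have "set \<tau>s \<subseteq> ?P" if "strictly_monotone d \<tau>s" for \<tau>s
    using that by (force simp: strictly_monotone_def intro!: permutes_swap_id)
  then have "hurwitz_tuples d k \<nu> \<mu> \<subseteq> ?P \<times> {xs. set xs \<subseteq> ?P \<and> length xs = k} \<times> ?P"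
    by (auto simp: hurwitz_tuples_def)
  then show ?thesis
    by (rule finite_subset) (intro finite_cartesian_product finite_permutations finite_lists_length_eq; simp add: finite_permutations)
qed

lemma finite_hurwitz_support:
  "finite {k. Poly_Mapping.single (int k) (hurwitz_number d k \<nu> \<mu>) \<noteq> 0}"
proof (rule finite_subset)
  show "{k. Poly_Mapping.single (int k) (hurwitz_number d k \<nu> \<mu>) \<noteq> 0} \<subseteq> {..d}"
  proof safe
    fix k assume nz: "Poly_Mapping.single (int k) (hurwitz_number d k \<nu> \<mu>) \<noteq> 0"
    have "hurwitz_tuples d k \<nu> \<mu> \<noteq> {}"
    proof
      assume "hurwitz_tuples d k \<nu> \<mu> = {}"
      then have "hurwitz_number d k \<nu> \<mu> = 0" by (simp add: hurwitz_number_def)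
      with nz show False by simp
    qed
    then show "k \<le> d" using strictly_monotone_length by (force simp: hurwitz_tuples_def)
  qed
qed simp

end

theory Submission
  imports Defs
begin

text \<open>
  Let \<open>\<sigma>0\<close>, \<open>\<sigma>1\<close>, \<open>\<sigma>2\<close> be the permutations of a map and \<open>B\<close> its set of boundary edges. The
  identity comes from cutting every vertex that meets the boundary into pieces, one for each of its
  boundary edges. Let \<open>\<pi>\<close> be the first return map of \<open>\<sigma>0\<close> to \<open>B\<close>, extended by the identity outside
  \<open>B\<close>. A cycle of \<open>\<pi>\<^sup>-\<^sup>1 \<circ> \<sigma>0\<close> contains at most one boundary edge (\<open>separates_first_return\<close>), so
  \<open>\<pi>\<^sup>-\<^sup>1 \<circ> \<sigma>0\<close>, \<open>\<sigma>1\<close>, \<open>\<sigma>2 \<circ> \<pi>\<close> are the permutations of a fully simple map with the same boundary edges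
  and the same internal faces. Conversely a fully simple map can be glued along an arbitrary
  permutation \<open>\<pi>\<close> of \<open>B\<close>, and \<open>\<pi>\<close> is then recovered as a first return map (\<open>first_return_comp\<close>).
  Hence maps correspond to pairs of a fully simple map and a permutation of its boundary edges.
  Gluing replaces the \<open>card B\<close> vertices on the boundary by one vertex for each cycle of \<open>\<pi>\<close>
  (\<open>card_cycles_comp\<close>), so it multiplies the weight by \<open>\<hbar>\<close> to the power \<open>card B\<close> minus the number
  of cycles of \<open>\<pi>\<close>.

  That exponent is the number of factors in the strictly monotone factorisation of \<open>\<pi>\<close>, which exists
  and is unique (\<open>strictly_monotone_factorisation\<close>, \<open>strictly_monotone_product\<close>). Therefore, if the
  boundary faces of a fully simple map have degrees \<open>\<mu>\<close>, the total weight of the gluings that produce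
  boundary faces of degrees \<open>\<nu>\<close> is \<open>z(\<mu>)\<close> times the Hurwitz series of \<open>\<nu>\<close> and \<open>\<mu>\<close>: the series
  averages over all permutations of cycle type \<open>\<mu>\<close>, these contribute equally, and there are
  \<open>d! / z(\<mu>)\<close> of them (\<open>reglue_sum_hurwitz\<close>).

  Cutting rearranges the boundary faces and is incompatible with their roots, so it is done on unrooted
  maps. Summing \<open>1 / |Aut M|\<close> over equivalence classes amounts to counting maps with darts
  \<open>0, \<dots>, N - 1\<close> and dividing by \<open>N!\<close> (\<open>weight_sum_labelled\<close>); and a boundary whose faces have
  degrees \<open>\<mu>\<close> can be rooted in \<open>z(\<mu>)\<close> ways (\<open>card_rootings\<close>). The
  factor \<open>z(\<nu>)\<close> thus splits off from the series of maps, and the factor \<open>z(\<mu>)\<close>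
  found above turns unrooted fully simple maps back into rooted ones.
\<close>

section \<open>Cycles of a permutation on an invariant set\<close>

text \<open>
  The hypothesis on \<open>f\<close> and \<open>A\<close> is \<open>f ` A = A\<close>, weaker than \<^term>\<open>f permutes A\<close>: it passes to unions
  of cycles, so that the face permutation of a map can be studied on the boundary edges alone, and
  cycles can be removed one by one, without modifying \<open>f\<close>.
\<close>

lemma perm_restrict_permutes:
  assumes "finite A" "f ` A = A"
  shows "perm_restrict f A permutes A"
proof (rule bij_imp_permutes)
  have "bij_betw f A A"
    using assms by (simp add: bij_betw_def eq_card_imp_inj_on)
  then show "bij_betw (perm_restrict f A) A A"
    by (simp add: perm_restrict_def cong: bij_betw_cong)
qed (simp add: perm_restrict_def)

lemma orbit_perm_restrict:
  assumes "f ` A = A" "x \<in> A"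
  shows "orbit (perm_restrict f A) x = orbit f x"
  using assms by (intro orbit_cong0[where A = A]) (auto simp: perm_restrict_def)

lemma cycles_on_perm_restrict:
  assumes "f ` A = A"
  shows "cycles_on (perm_restrict f A) A = cycles_on f A"
  using orbit_perm_restrict[OF assms] by (auto simp: cycles_on_def)

lemma orbit_subset_invariant:
  assumes "f ` A = A" "x \<in> A"
  shows "orbit f x \<subseteq> A"
proof
  fix y assume "y \<in> orbit f x"
  then show "y \<in> A" by induction (use assms in auto)
qed

lemma self_in_orbit:
  assumes "finite A" "f ` A = A" "x \<in> A"
  shows "x \<in> orbit f x"
proof -
  have "permutation (perm_restrict f A)"
    using perm_restrict_permutes[OF assms(1,2)] assms(1) by (auto simp: permutation_permutes)
  then show ?thesis
    using orbit_perm_restrict[OF assms(2,3)] permutation_self_in_orbit by metis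
qed

lemma orbit_eq:
  assumes "finite A" "f ` A = A" "x \<in> A" "y \<in> orbit f x"
  shows "orbit f y = orbit f x"
proof -
  have x: "x \<in> orbit f x" using assms(1-3) by (rule self_in_orbit)
  then have "x \<in> orbit f y" using assms(4) by (rule orbit_swap)
  then show ?thesis using assms(4) orbit_trans by (metis subsetI subset_antisym)
qed

lemma orbit_eq_iff:
  assumes "finite A" "f ` A = A" "x \<in> A" "y \<in> A"
  shows "orbit f x = orbit f y \<longleftrightarrow> x \<in> orbit f y"
  using orbit_eq[OF assms(1,2,4)] self_in_orbit[OF assms(1-3)] by blast

lemma finite_cycles_on: "finite A \<Longrightarrow> finite (cycles_on f A)"
  by (simp add: cycles_on_def)

lemma Union_cycles_on:
  assumes "finite A" "f ` A = A"
  shows "\<Union> (cycles_on f A) = A"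
  using orbit_subset_invariant[OF assms(2)] self_in_orbit[OF assms] by (auto simp: cycles_on_def)

lemma disjoint_cycles_on:
  assumes "finite A" "f ` A = A" "c \<in> cycles_on f A" "c' \<in> cycles_on f A" "c \<noteq> c'"
  shows "c \<inter> c' = {}"
proof (rule ccontr)
  assume "c \<inter> c' \<noteq> {}"
  then obtain z where "z \<in> c" "z \<in> c'" by blast
  then have "c = orbit f z" "c' = orbit f z"
    using assms(3,4) orbit_eq[OF assms(1,2)] unfolding cycles_on_def by blast+
  then show False using assms(5) by simp
qed

lemma image_Diff_orbit:
  assumes "finite A" "f ` A = A" "x \<in> A"
  shows "f ` (A - orbit f x) = A - orbit f x"
proof -
  have inj: "inj_on f A" using assms by (simp add: eq_card_imp_inj_on)
  have sub: "orbit f x \<subseteq> A" using assms by (simp add: orbit_subset_invariant)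
  have fin: "finite (orbit f x)" using sub assms(1) by (rule finite_subset)
  have "f ` orbit f x \<subseteq> orbit f x" by (auto intro: orbit.step)
  then have "f ` orbit f x = orbit f x"
    using fin inj_on_subset[OF inj sub] by (metis card_image card_subset_eq)
  then show ?thesis
    using inj_on_image_set_diff[OF inj Diff_subset sub] assms(2) by simp
qed

lemma cycles_on_remove:
  assumes "finite A" "f ` A = A" "x \<in> A"
  shows "cycles_on f A = insert (orbit f x) (cycles_on f (A - orbit f x))"
    and "orbit f x \<notin> cycles_on f (A - orbit f x)"
proof -
  have "orbit f y = orbit f x" if "y \<in> orbit f x" for y
    using orbit_eq[OF assms that] .
  then show "cycles_on f A = insert (orbit f x) (cycles_on f (A - orbit f x))"
    using assms(3) by (auto simp: cycles_on_def)
  have "orbit f x \<noteq> orbit f y" if "y \<in> A - orbit f x" for y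
    using self_in_orbit[OF assms(1,2)] that by auto
  then show "orbit f x \<notin> cycles_on f (A - orbit f x)"
    by (auto simp: cycles_on_def)
qed

lemma cycle_type_remove:
  assumes "finite A" "f ` A = A" "x \<in> A"
  shows "cycle_type f A = add_mset (card (orbit f x)) (cycle_type f (A - orbit f x))"
  using cycles_on_remove[OF assms] assms(1) by (simp add: cycle_type_def finite_cycles_on)

lemma cycles_on_cong:
  assumes "\<And>x. x \<in> A \<Longrightarrow> f x = g x" "f ` A \<subseteq> A"
  shows "cycles_on f A = cycles_on g A"
proof -
  have "orbit f x = orbit g x" if "x \<in> A" for x
    using that assms by (intro orbit_cong0[where A = A]) auto
  then show ?thesis by (auto simp: cycles_on_def)
qed

lemma cycles_on_transport:
  assumes "f ` A = A" "finite A" "\<And>x. x \<in> A \<Longrightarrow> g (\<phi> x) = \<phi> (f x)"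
  shows "cycles_on g (\<phi> ` A) = image \<phi> ` cycles_on f A"
proof -
  have "cycles_on g (\<phi> ` A) = image \<phi> ` cycles_on (perm_restrict f A) A"
    by (rule cycles_on_intertwine[OF perm_restrict_permutes])
      (use assms in \<open>auto simp: perm_restrict_def\<close>)
  then show ?thesis by (simp only: cycles_on_perm_restrict[OF assms(1)])
qed

lemma cycle_type_transport:
  assumes "f ` A = A" "finite A" "bij_betw \<phi> A A'" "\<And>x. x \<in> A \<Longrightarrow> g (\<phi> x) = \<phi> (f x)"
  shows "cycle_type g A' = cycle_type f A" and "card (cycles_on g A') = card (cycles_on f A)"
proof -
  have A': "A' = \<phi> ` A" and inj: "inj_on \<phi> A" using assms(3) by (auto simp: bij_betw_def)
  have C: "cycles_on g A' = image \<phi> ` cycles_on f A"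
    unfolding A' using assms(1,2,4) by (rule cycles_on_transport)
  have sub: "c \<subseteq> A" if "c \<in> cycles_on f A" for c
    using that orbit_subset_invariant[OF assms(1)] by (auto simp: cycles_on_def)
  have injC: "inj_on (image \<phi>) (cycles_on f A)"
    using inj_on_image_Pow[OF inj] by (rule inj_on_subset) (use sub in auto)
  then show "card (cycles_on g A') = card (cycles_on f A)" by (simp add: C card_image)
  have "card (\<phi> ` c) = card c" if "c \<in> cycles_on f A" for c
    using inj_on_subset[OF inj sub[OF that]] by (rule card_image)
  then have "image_mset (card \<circ> image \<phi>) (mset_set (cycles_on f A)) = cycle_type f A"
    unfolding cycle_type_def by (intro image_mset_cong) (simp add: finite_cycles_on assms(2))
  then show "cycle_type g A' = cycle_type f A"
    unfolding cycle_type_def C by (simp add: image_mset_mset_set[OF injC, symmetric] multiset.map_comp)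
qed

lemma cycles_on_inv:
  assumes "finite A" "f permutes A"
  shows "cycles_on (inv f) A = cycles_on f A"
  using assms by (simp add: cycles_on_def orbit_inv_eq permutation_permutes exI[of _ A] cong: image_cong)

lemma cycle_type_inv:
  assumes "finite A" "f permutes A"
  shows "cycle_type (inv f) A = cycle_type f A"
  using cycles_on_inv[OF assms] by (simp add: cycle_type_def)

lemma sum_mset_cycle_type:
  assumes "finite A" "f ` A = A"
  shows "sum_mset (cycle_type f A) = card A"
proof -
  have "card A = card (\<Union> (cycles_on f A))" by (simp only: Union_cycles_on[OF assms])
  also have "\<dots> = (\<Sum>c\<in>cycles_on f A. card c)"
  proof (rule card_Union_disjoint)
    show "pairwise disjnt (cycles_on f A)"
      using disjoint_cycles_on[OF assms] by (simp add: pairwise_def disjnt_def)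
    show "finite c" if "c \<in> cycles_on f A" for c
      using that orbit_subset_invariant[OF assms(2)] assms(1)
      by (auto simp: cycles_on_def intro: finite_subset)
  qed
  finally show ?thesis by (simp add: cycle_type_def sum_unfold_sum_mset)
qed

lemma cycle_type_pos:
  assumes "finite A" "f ` A = A" "p \<in># cycle_type f A"
  shows "p > 0"
proof -
  obtain x where x: "x \<in> A" "p = card (orbit f x)"
    using assms(1,3) by (auto simp: cycle_type_def finite_cycles_on) (auto simp: cycles_on_def)
  then show ?thesis
    using finite_subset[OF orbit_subset_invariant[OF assms(2) x(1)] assms(1)] orbit_nonempty[of f x]
    by (simp add: card_gt_0_iff)
qed

lemma card_in_cycles_of_length:
  assumes "finite A" "f ` A = A"
  shows "card {x \<in> A. card (orbit f x) = k} = k * count (cycle_type f A) k"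
proof -
  let ?C = "{c \<in> cycles_on f A. card c = k}"
  have "{x \<in> A. card (orbit f x) = k} = \<Union> ?C"
  proof (intro equalityI subsetI)
    fix x assume "x \<in> {x \<in> A. card (orbit f x) = k}"
    then show "x \<in> \<Union> ?C" using self_in_orbit[OF assms, of x] by (auto simp: cycles_on_def)
  next
    fix x assume "x \<in> \<Union> ?C"
    then obtain y where y: "y \<in> A" "x \<in> orbit f y" "card (orbit f y) = k"
      by (auto simp: cycles_on_def)
    have "x \<in> A" using y orbit_subset_invariant[OF assms(2)] by blast
    then show "x \<in> {x \<in> A. card (orbit f x) = k}"
      using orbit_eq[OF assms y(1,2)] y(3) by simp
  qed
  moreover have "card (\<Union> ?C) = (\<Sum>c\<in>?C. card c)"
  proof (rule card_Union_disjoint)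
    show "pairwise disjnt ?C"
      using disjoint_cycles_on[OF assms] by (simp add: pairwise_def disjnt_def)
    show "finite c" if "c \<in> ?C" for c
      using that orbit_subset_invariant[OF assms(2)] assms(1)
      by (auto simp: cycles_on_def intro: finite_subset)
  qed
  moreover have "count (cycle_type f A) k = card ?C"
  proof -
    have "?C = card -` {k} \<inter> cycles_on f A" by auto
    then show ?thesis
      using assms(1) by (simp add: cycle_type_def count_image_mset finite_cycles_on)
  qed
  ultimately show ?thesis by simp
qed

section \<open>Choosing a root in every cycle\<close>

definition rootings :: "('a \<Rightarrow> 'a) \<Rightarrow> 'a set \<Rightarrow> nat list \<Rightarrow> 'a list set" where
  "rootings f A \<mu> = {R. set R \<subseteq> A \<and> map (\<lambda>r. card (orbit f r)) R = \<mu> \<and>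
     distinct (map (orbit f) R) \<and> \<Union> (orbit f ` set R) = A}"

lemma Nil_in_rootings: "[] \<in> rootings f A \<mu> \<longleftrightarrow> A = {} \<and> \<mu> = []"
  by (auto simp: rootings_def)

lemma Cons_in_rootings:
  assumes "finite A" "f ` A = A"
  shows "r # R \<in> rootings f A \<mu> \<longleftrightarrow> r \<in> A \<and>
    (\<exists>\<mu>'. \<mu> = card (orbit f r) # \<mu>' \<and> R \<in> rootings f (A - orbit f r) \<mu>')"
proof (cases "r \<in> A")
  case True
  have disj: "orbit f r \<noteq> orbit f x \<longleftrightarrow> orbit f x \<inter> orbit f r = {}" if "x \<in> A" for x
  proof -
    have "orbit f x \<in> cycles_on f A" "orbit f r \<in> cycles_on f A"
      using that True by (auto simp: cycles_on_def)
    then show ?thesis using disjoint_cycles_on[OF assms] orbit_nonempty[of f r] by fastforce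
  qed
  have mem: "x \<notin> orbit f r \<longleftrightarrow> orbit f r \<noteq> orbit f x" if "x \<in> A" for x
    using orbit_eq_iff[OF assms that True] by auto
  have sub: "orbit f r \<subseteq> A" using orbit_subset_invariant[OF assms(2) True] .
  have 1: "orbit f r \<notin> orbit f ` set R \<longleftrightarrow> set R \<inter> orbit f r = {}" if "set R \<subseteq> A"
    using that mem by blast
  have 2: "orbit f r \<union> \<Union> (orbit f ` set R) = A \<longleftrightarrow> \<Union> (orbit f ` set R) = A - orbit f r"
    if "set R \<subseteq> A" "orbit f r \<notin> orbit f ` set R"
  proof -
    have "\<Union> (orbit f ` set R) \<inter> orbit f r = {}"
      using that disj by blast
    then show ?thesis using sub by blast
  qed
  have 3: "set R \<subseteq> A - orbit f r \<longleftrightarrow> set R \<subseteq> A \<and> orbit f r \<notin> orbit f ` set R"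
    using 1 by blast
  show ?thesis using True 2 3 by (auto simp: rootings_def)
qed (auto simp: rootings_def)

lemma finite_rootings: "finite A \<Longrightarrow> finite (rootings f A \<mu>)"
  by (rule finite_subset[OF _ finite_lists_length_eq[of A "length \<mu>"]])
    (auto simp: rootings_def)

lemma z_partition_Nil: "z_partition [] = 1"
  by (simp add: z_partition_def)

lemma z_partition_Cons:
  "z_partition (k # \<mu>) = k * Suc (count_list \<mu> k) * z_partition \<mu>"
proof -
  let ?c = "\<lambda>j. fact (count_list \<mu> j) :: nat"
  have "(\<Prod>j\<in>set (k # \<mu>). fact (count_list (k # \<mu>) j)) =
      fact (Suc (count_list \<mu> k)) * (\<Prod>j\<in>set \<mu> - {k}. ?c j)"
    by (simp add: prod.insert_remove del: fact_Suc)
  also have "\<dots> = Suc (count_list \<mu> k) * (\<Prod>j\<in>insert k (set \<mu>). ?c j)"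
    by (simp add: prod.insert_remove algebra_simps)
  also have "(\<Prod>j\<in>insert k (set \<mu>). ?c j) = (\<Prod>j\<in>set \<mu>. ?c j)"
    by (cases "k \<in> set \<mu>") (simp_all add: insert_absorb count_list_0_iff[THEN iffD2])
  finally show ?thesis by (simp only: z_partition_def prod_list.Cons mult_ac)
qed

text \<open>
  The first root is any of the \<open>k \<cdot> m\<close> elements of the \<open>m\<close> cycles whose length \<open>k\<close> is the first
  part of \<open>\<mu>\<close>. Removing its cycle leaves the same problem with \<open>m - 1\<close> cycles of length \<open>k\<close>, which
  is the recursion for \<open>z\<close> in \<open>z_partition_Cons\<close>.
\<close>

theorem card_rootings:
  assumes "finite A" "f ` A = A" "cycle_type f A = mset \<mu>"
  shows "card (rootings f A \<mu>) = z_partition \<mu>"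
  using assms
proof (induction \<mu> arbitrary: A)
  case Nil
  have "A = {}"
    using Nil.prems sum_mset_cycle_type[OF Nil.prems(1,2)] by simp
  then have "rootings f A [] = {[]}" by (auto simp: rootings_def)
  then show ?case by (simp add: z_partition_Nil)
next
  case (Cons k \<mu>)
  let ?S = "{r \<in> A. card (orbit f r) = k}"
  let ?T = "\<lambda>r. rootings f (A - orbit f r) \<mu>"
  have "rootings f A (k # \<mu>) = (\<lambda>(r, R). r # R) ` (SIGMA r : ?S. ?T r)"
  proof (rule set_eqI)
    fix R show "R \<in> rootings f A (k # \<mu>) \<longleftrightarrow> R \<in> (\<lambda>(r, R). r # R) ` (SIGMA r : ?S. ?T r)"
      by (cases R) (auto simp: Nil_in_rootings Cons_in_rootings[OF Cons.prems(1,2)])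
  qed
  moreover have "inj_on (\<lambda>(r, R). r # R) (SIGMA r : ?S. ?T r)" by (auto simp: inj_on_def)
  ultimately have "card (rootings f A (k # \<mu>)) = card (SIGMA r : ?S. ?T r)"
    by (simp add: card_image)
  also have "\<dots> = (\<Sum>r\<in>?S. card (?T r))"
    using Cons.prems(1) by (simp add: card_SigmaI finite_rootings)
  also have "\<dots> = (\<Sum>r\<in>?S. z_partition \<mu>)"
  proof (rule sum.cong)
    fix r assume r: "r \<in> ?S"
    have "cycle_type f (A - orbit f r) = mset \<mu>"
      using cycle_type_remove[OF Cons.prems(1,2), of r] r Cons.prems(3) by simp
    then show "card (?T r) = z_partition \<mu>"
      using r Cons.prems(1) image_Diff_orbit[OF Cons.prems(1,2), of r]
      by (intro Cons.IH) simp_all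
  qed simp
  also have "\<dots> = z_partition (k # \<mu>)"
    using card_in_cycles_of_length[OF Cons.prems(1,2), of k] Cons.prems(3)
    by (simp add: z_partition_Cons flip: count_mset)
  finally show ?case .
qed

lemma cycle_type_rooting:
  assumes "finite A" "f ` A = A" "R \<in> rootings f A \<mu>"
  shows "cycle_type f A = mset \<mu>"
  using assms
proof (induction R arbitrary: A \<mu>)
  case Nil
  then show ?case by (simp add: Nil_in_rootings cycle_type_def cycles_on_def)
next
  case (Cons r R)
  then obtain \<mu>' where "r \<in> A" "\<mu> = card (orbit f r) # \<mu>'" "R \<in> rootings f (A - orbit f r) \<mu>'"
    by (auto simp: Cons_in_rootings)
  then show ?case
    using Cons.IH[of "A - orbit f r" \<mu>'] Cons.prems cycle_type_remove[of A f r]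
    by (simp add: image_Diff_orbit)
qed

lemma z_partition_pos:
  assumes "\<forall>p\<in>set \<mu>. p > 0"
  shows "z_partition \<mu> > 0"
  using assms by (induction \<mu>) (simp_all add: z_partition_Nil z_partition_Cons)

lemma ex_rooting:
  assumes "finite A" "f ` A = A" "cycle_type f A = mset \<mu>"
  obtains R where "R \<in> rootings f A \<mu>"
proof -
  have "p > 0" if "p \<in> set \<mu>" for p
    using cycle_type_pos[OF assms(1,2), of p] that by (simp add: assms(3))
  then have "card (rootings f A \<mu>) > 0"
    using card_rootings[OF assms] z_partition_pos by simp
  then show ?thesis using that by (metis card.empty less_irrefl ex_in_conv)
qed

lemma cycle_intertwiner:
  assumes "r \<in> orbit f r" "r' \<in> orbit f' r'" "card (orbit f r) = card (orbit f' r')"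
  obtains \<phi> where "bij_betw \<phi> (orbit f r) (orbit f' r')" "\<phi> r = r'"
    "\<And>x. x \<in> orbit f r \<Longrightarrow> \<phi> (f x) = f' (\<phi> x)"
proof -
  define k where "k = card (orbit f r)"
  have len: "funpow_dist1 g s s = card (orbit g s)" if "s \<in> orbit g s" for g :: "'c \<Rightarrow> 'c" and s
    using card_image[OF inj_on_funpow_dist1[OF that]] orbit_conv_funpow_dist1[OF that] by simp
  have k: "funpow_dist1 f r r = k" using len[OF assms(1)] by (simp only: k_def)
  have k': "funpow_dist1 f' r' r' = k" using len[OF assms(2)] assms(3) by (simp only: k_def)
  have per: "(f ^^ k) r = r" "(f' ^^ k) r' = r'"
    using funpow_dist1_prop[OF assms(1)] funpow_dist1_prop[OF assms(2)] unfolding k k' .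
  have bf: "bij_betw (\<lambda>n. (f ^^ n) r) {0..<k} (orbit f r)"
    using inj_on_funpow_dist1[OF assms(1)] orbit_conv_funpow_dist1[OF assms(1)]
    unfolding k bij_betw_def by simp
  have bf': "bij_betw (\<lambda>n. (f' ^^ n) r') {0..<k} (orbit f' r')"
    using inj_on_funpow_dist1[OF assms(2)] orbit_conv_funpow_dist1[OF assms(2)]
    unfolding k' bij_betw_def by simp
  \<comment> \<open>the \<open>n\<close>-th iterate of \<open>r\<close> goes to the \<open>n\<close>-th iterate of \<open>r'\<close>; this is consistent
    because the periods agree\<close>
  define \<phi> where "\<phi> = (\<lambda>n. (f' ^^ n) r') \<circ> inv_into {0..<k} (\<lambda>n. (f ^^ n) r)"
  have pos: "k > 0" using k by simp
  have \<phi>0: "\<phi> ((f ^^ n) r) = (f' ^^ n) r'" if "n < k" for n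
    using bij_betw_inv_into_left[OF bf] that by (simp add: \<phi>_def)
  have \<phi>: "\<phi> ((f ^^ n) r) = (f' ^^ n) r'" for n
  proof -
    have "(f ^^ n) r = (f ^^ (n mod k)) r" "(f' ^^ n) r' = (f' ^^ (n mod k)) r'"
      using per by (simp_all add: funpow_mod_eq)
    then show ?thesis using \<phi>0[of "n mod k"] pos by simp
  qed
  show thesis
  proof
    show "bij_betw \<phi> (orbit f r) (orbit f' r')"
      unfolding \<phi>_def by (rule bij_betw_trans[OF bij_betw_inv_into[OF bf] bf'])
    show "\<phi> r = r'" using \<phi>[of 0] by simp
    fix x assume "x \<in> orbit f r"
    then obtain n where "x = (f ^^ n) r" by (auto simp: orbit_altdef)
    then show "\<phi> (f x) = f' (\<phi> x)" using \<phi>[of n] \<phi>[of "Suc n"] by simp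
  qed
qed

text \<open>
  Roots rigidify a permutation: mapping root to root leaves a single way to map every cycle, and two
  rooted permutations with the same cycle lengths in the same order are conjugate by exactly one
  bijection. Existence is shown here, uniqueness in \<open>intertwiner_determined\<close>.
\<close>

lemma rooting_intertwiner:
  assumes "finite A" "f ` A = A" "R \<in> rootings f A \<mu>"
    and "finite A'" "f' ` A' = A'" "R' \<in> rootings f' A' \<mu>"
  shows "\<exists>\<phi>. bij_betw \<phi> A A' \<and> (\<forall>x\<in>A. \<phi> (f x) = f' (\<phi> x)) \<and> map \<phi> R = R'"
  using assms
proof (induction \<mu> arbitrary: A A' R R')
  case Nil
  then have "A = {}" "A' = {}" "R = []" "R' = []" by (auto simp: rootings_def)
  then show ?case by (auto simp: bij_betw_def)
next
  case (Cons k \<mu>)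
  obtain r S where R: "R = r # S" using Cons.prems by (cases R) (auto simp: rootings_def)
  obtain r' S' where R': "R' = r' # S'" using Cons.prems by (cases R') (auto simp: rootings_def)
  let ?C = "orbit f r" and ?C' = "orbit f' r'"
  have r: "r \<in> A" "card ?C = k" "S \<in> rootings f (A - ?C) \<mu>"
    using Cons.prems by (auto simp: R Cons_in_rootings)
  have r': "r' \<in> A'" "card ?C' = k" "S' \<in> rootings f' (A' - ?C') \<mu>"
    using Cons.prems by (auto simp: R' Cons_in_rootings)
  have sub: "?C \<subseteq> A" "?C' \<subseteq> A'"
    using r(1) r'(1) Cons.prems orbit_subset_invariant by metis+
  have inv: "f ` (A - ?C) = A - ?C" "f' ` (A' - ?C') = A' - ?C'"
    using image_Diff_orbit r(1) r'(1) Cons.prems by metis+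
  obtain \<psi> where \<psi>: "bij_betw \<psi> (A - ?C) (A' - ?C')" "\<forall>x\<in>A - ?C. \<psi> (f x) = f' (\<psi> x)" "map \<psi> S = S'"
    using Cons.IH[OF _ inv(1) r(3) _ inv(2) r'(3)] Cons.prems by auto
  obtain \<chi> where \<chi>: "bij_betw \<chi> ?C ?C'" "\<chi> r = r'" "\<And>x. x \<in> ?C \<Longrightarrow> \<chi> (f x) = f' (\<chi> x)"
    using cycle_intertwiner[of r f r' f'] self_in_orbit[of A f r] self_in_orbit[of A' f' r'] r r' Cons.prems
    by auto
  define \<phi> where "\<phi> = (\<lambda>x. if x \<in> ?C then \<chi> x else \<psi> x)"
  have "bij_betw \<phi> (?C \<union> (A - ?C)) (?C' \<union> (A' - ?C'))"
  proof (rule bij_betw_combine)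
    show "bij_betw \<phi> ?C ?C'" using \<chi>(1) by (rule bij_betw_cong[THEN iffD1, rotated]) (simp add: \<phi>_def)
    show "bij_betw \<phi> (A - ?C) (A' - ?C')" using \<psi>(1) by (rule bij_betw_cong[THEN iffD1, rotated]) (simp add: \<phi>_def)
  qed auto
  then have "bij_betw \<phi> A A'" using sub by (simp add: Un_absorb1)
  moreover have "\<phi> (f x) = f' (\<phi> x)" if "x \<in> A" for x
  proof (cases "x \<in> ?C")
    case True
    then show ?thesis using \<chi>(3) by (simp add: \<phi>_def orbit.step)
  next
    case False
    then have "f x \<in> A - ?C" using inv(1) that by blast
    then show ?thesis using \<psi>(2) that False by (simp add: \<phi>_def)
  qed
  moreover have "map \<phi> R = R'"
  proof -
    have "set S \<subseteq> A - ?C" using r(3) by (auto simp: rootings_def)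
    then have "map \<phi> S = map \<psi> S" by (auto simp: \<phi>_def)
    then show ?thesis
      using \<chi>(2) \<psi>(3) self_in_orbit[of A f r] r(1) Cons.prems by (simp add: R R' \<phi>_def)
  qed
  ultimately show ?case by blast
qed

lemma intertwiner_determined:
  assumes "R \<in> rootings f A \<mu>" "f ` A = A"
    and "\<forall>x\<in>A. \<phi> (f x) = f' (\<phi> x)" "\<forall>x\<in>A. \<psi> (f x) = f' (\<psi> x)" "map \<phi> R = map \<psi> R"
    and "x \<in> A"
  shows "\<phi> x = \<psi> x"
proof -
  obtain r where r: "r \<in> set R" "x \<in> orbit f r" using assms(1,6) by (auto simp: rootings_def)
  have "r \<in> A" using r(1) assms(1) by (auto simp: rootings_def)
  have "y \<in> A \<and> \<phi> y = \<psi> y" if "y \<in> orbit f r" for y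
    using that
  proof induction
    case base
    show ?case using r(1) \<open>r \<in> A\<close> assms(2-5) by auto
  next
    case (step y)
    then show ?case using assms(2-4) by auto
  qed
  then show ?thesis using r(2) by blast
qed

lemma cycle_type_intertwiner:
  assumes "finite A" "f ` A = A" "finite A'" "f' ` A' = A'" "cycle_type f A = cycle_type f' A'"
  obtains \<phi> where "bij_betw \<phi> A A'" "\<forall>x\<in>A. \<phi> (f x) = f' (\<phi> x)"
proof -
  obtain \<mu> where \<mu>: "mset \<mu> = cycle_type f A" using ex_mset by blast
  obtain R where "R \<in> rootings f A \<mu>" using ex_rooting[OF assms(1,2)] \<mu> by metis
  moreover obtain R' where "R' \<in> rootings f' A' \<mu>" using ex_rooting[OF assms(3,4)] \<mu> assms(5) by metis
  ultimately show ?thesis using rooting_intertwiner[OF assms(1,2) _ assms(3,4)] that by metis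
qed

section \<open>The size of a conjugacy class\<close>

lemma orbit_transport:
  assumes "f ` A = A" "finite A" "\<And>y. y \<in> A \<Longrightarrow> g (\<phi> y) = \<phi> (f y)" "x \<in> A"
  shows "orbit g (\<phi> x) = \<phi> ` orbit f x"
  using orbit_inverse[of x f g \<phi>] self_in_orbit[OF assms(2,1,4)]
    orbit_subset_invariant[OF assms(1,4)] assms(3) by blast

lemma rootings_transport:
  assumes "f ` A = A" "finite A" "bij_betw \<phi> A A'" "\<And>x. x \<in> A \<Longrightarrow> g (\<phi> x) = \<phi> (f x)"
    and R: "R \<in> rootings f A \<mu>"
  shows "map \<phi> R \<in> rootings g A' \<mu>"
proof -
  have inj: "inj_on \<phi> A" and A': "A' = \<phi> ` A" using assms(3) by (auto simp: bij_betw_def)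
  have sub: "set R \<subseteq> A" using R by (simp add: rootings_def)
  have orb: "orbit g (\<phi> r) = \<phi> ` orbit f r" if "r \<in> set R" for r
    by (rule orbit_transport[where A = A]) (use assms that sub in auto)
  have orbA: "orbit f r \<subseteq> A" if "r \<in> set R" for r
    using orbit_subset_invariant[OF assms(1)] that sub by blast
  have "card (orbit g (\<phi> r)) = card (orbit f r)" if "r \<in> set R" for r
    using orb[OF that] inj_on_subset[OF inj orbA[OF that]] by (simp add: card_image)
  moreover have "distinct (map (\<lambda>r. orbit g (\<phi> r)) R)"
  proof -
    have "distinct (map (image \<phi>) (map (orbit f) R))"
      using R orbA inj_on_subset[OF inj_on_image_Pow[OF inj]]
      by (subst distinct_map) (auto simp: rootings_def image_subset_iff)
    moreover have "map (\<lambda>r. orbit g (\<phi> r)) R = map (image \<phi>) (map (orbit f) R)"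
      using orb by simp
    ultimately show ?thesis by metis
  qed
  moreover have "\<Union> (orbit g ` \<phi> ` set R) = A'"
  proof -
    have "\<Union> (orbit g ` \<phi> ` set R) = \<phi> ` \<Union> (orbit f ` set R)"
      using orb by (simp add: image_UN)
    then show ?thesis using R by (simp add: rootings_def A')
  qed
  moreover have "map (\<lambda>r. card (orbit f r)) R = \<mu>" using R by (simp add: rootings_def)
  ultimately show ?thesis using sub by (auto simp: rootings_def A' o_def)
qed

text \<open>
  Fix a rooting of \<open>\<rho>\<close>. Permutations of \<open>A\<close> act by conjugation on pairs of a permutation of cycle
  type \<open>\<mu>\<close> and a rooting of it. By \<open>rooting_intertwiner\<close> and \<open>intertwiner_determined\<close> the action is
  simply transitive, so there are \<open>(card A)!\<close> pairs; on the other hand each permutation has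
  \<open>z(\<mu>)\<close> rootings.
\<close>

theorem card_conjugacy_class:
  assumes fin: "finite A" and \<rho>: "\<rho> permutes A" and type: "cycle_type \<rho> A = mset \<mu>"
  shows "card {\<sigma>. \<sigma> permutes A \<and> cycle_type \<sigma> A = mset \<mu>} * z_partition \<mu> = fact (card A)"
proof -
  let ?C = "{\<sigma>. \<sigma> permutes A \<and> cycle_type \<sigma> A = mset \<mu>}"
  let ?P = "SIGMA \<sigma> : ?C. rootings \<sigma> A \<mu>"
  obtain R where R: "R \<in> rootings \<rho> A \<mu>"
    using ex_rooting[OF fin permutes_image[OF \<rho>] type] .
  let ?F = "\<lambda>\<phi>. (\<phi> \<circ> \<rho> \<circ> inv \<phi>, map \<phi> R)"
  have comm: "(\<phi> \<circ> \<rho> \<circ> inv \<phi>) (\<phi> x) = \<phi> (\<rho> x)" if "\<phi> permutes A" for \<phi> x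
    using permutes_inverses[OF that] by simp
  have "inj_on ?F {\<phi>. \<phi> permutes A}"
  proof (rule inj_onI)
    fix \<phi> \<psi> assume \<phi>: "\<phi> \<in> {\<phi>. \<phi> permutes A}" and \<psi>: "\<psi> \<in> {\<phi>. \<phi> permutes A}" and eq: "?F \<phi> = ?F \<psi>"
    show "\<phi> = \<psi>"
    proof
      fix x show "\<phi> x = \<psi> x"
      proof (cases "x \<in> A")
        case True
        show ?thesis
          by (rule intertwiner_determined[OF R permutes_image[OF \<rho>] _ _ _ True,
                where f' = "\<phi> \<circ> \<rho> \<circ> inv \<phi>"])
            (use comm \<phi> \<psi> eq in \<open>metis Pair_inject mem_Collect_eq\<close>)+
      qed (use \<phi> \<psi> in \<open>simp add: permutes_not_in\<close>)
    qed
  qed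
  moreover have "?F ` {\<phi>. \<phi> permutes A} = ?P"
  proof (intro equalityI subsetI)
    fix p assume "p \<in> ?F ` {\<phi>. \<phi> permutes A}"
    then obtain \<phi> where \<phi>: "\<phi> permutes A" "p = ?F \<phi>" by auto
    have perm: "\<phi> \<circ> \<rho> \<circ> inv \<phi> permutes A"
      using \<phi>(1) \<rho> by (intro permutes_compose permutes_inv)
    have "map \<phi> R \<in> rootings (\<phi> \<circ> \<rho> \<circ> inv \<phi>) A \<mu>"
      by (rule rootings_transport[OF permutes_image[OF \<rho>] fin permutes_imp_bij[OF \<phi>(1)] comm[OF \<phi>(1)] R])
    then show "p \<in> ?P"
      using perm \<phi>(2) cycle_type_rooting[OF fin permutes_image[OF perm]] by simp
  next
    fix p assume "p \<in> ?P"
    then obtain \<sigma> S where p: "p = (\<sigma>, S)" "\<sigma> permutes A" "S \<in> rootings \<sigma> A \<mu>" by auto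
    obtain \<psi> where \<psi>: "bij_betw \<psi> A A" "\<forall>x\<in>A. \<psi> (\<rho> x) = \<sigma> (\<psi> x)" "map \<psi> R = S"
      using rooting_intertwiner[OF fin permutes_image[OF \<rho>] R fin permutes_image[OF p(2)] p(3)] by blast
    define \<phi> where "\<phi> = perm_restrict \<psi> A"
    have \<phi>: "\<phi> permutes A"
      using \<psi>(1) fin unfolding \<phi>_def by (intro perm_restrict_permutes) (auto simp: bij_betw_def)
    have "(\<phi> \<circ> \<rho> \<circ> inv \<phi>) y = \<sigma> y" for y
    proof (cases "y \<in> A")
      case True
      then obtain x where x: "x \<in> A" "y = \<phi> x" using permutes_image[OF \<phi>] by blast
      have "\<rho> x \<in> A" using x(1) \<rho> by (simp add: permutes_in_image)
      moreover have "inv \<phi> y = x" using x(2) permutes_inverses(2)[OF \<phi>] by simp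
      ultimately show ?thesis using x \<psi>(2) by (simp add: \<phi>_def perm_restrict_simps)
    next
      case False
      then show ?thesis
        using \<phi> \<rho> p(2) permutes_inv[OF \<phi>] by (simp add: permutes_not_in)
    qed
    moreover have "map \<phi> R = S"
    proof -
      have "set R \<subseteq> A" using R by (simp add: rootings_def)
      then have "map \<phi> R = map \<psi> R" by (auto simp: \<phi>_def perm_restrict_def)
      then show ?thesis using \<psi>(3) by simp
    qed
    ultimately show "p \<in> ?F ` {\<phi>. \<phi> permutes A}"
      using \<phi> p(1) by (intro image_eqI[of _ _ \<phi>]) auto
  qed
  ultimately have "card ?P = card {\<phi>. \<phi> permutes A}" using card_image by fastforce
  then have "fact (card A) = card ?P" using card_permutations[OF refl fin] by simp
  also have "\<dots> = (\<Sum>\<sigma>\<in>?C. card (rootings \<sigma> A \<mu>))"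
    using fin by (intro card_SigmaI) (auto simp: finite_rootings finite_permutations)
  also have "\<dots> = (\<Sum>\<sigma>\<in>?C. z_partition \<mu>)"
    using card_rootings[OF fin] by (intro sum.cong) (auto simp: permutes_image)
  finally show ?thesis by simp
qed

section \<open>First return maps\<close>

definition return_time :: "('a \<Rightarrow> 'a) \<Rightarrow> 'a set \<Rightarrow> 'a \<Rightarrow> nat" where
  "return_time s B x = (LEAST n. 0 < n \<and> (s ^^ n) x \<in> B)"

definition first_return :: "('a \<Rightarrow> 'a) \<Rightarrow> 'a set \<Rightarrow> 'a \<Rightarrow> 'a" where
  "first_return s B x = (s ^^ return_time s B x) x"

lemma return_time:
  assumes "finite A" "s ` A = A" "B \<subseteq> A" "x \<in> B"
  shows "0 < return_time s B x" "first_return s B x \<in> B"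
    and "\<And>n. 0 < n \<Longrightarrow> (s ^^ n) x \<in> B \<Longrightarrow> return_time s B x \<le> n"
proof -
  have "x \<in> orbit s x" using assms by (auto intro: self_in_orbit)
  then obtain n where "0 < n" "x = (s ^^ n) x" by (auto simp: orbit_altdef)
  then have "0 < n \<and> (s ^^ n) x \<in> B" using assms(4) by simp
  then have *: "0 < return_time s B x \<and> (s ^^ return_time s B x) x \<in> B"
    unfolding return_time_def by (rule LeastI)
  then show "0 < return_time s B x" "first_return s B x \<in> B"
    by (simp_all add: first_return_def)
  show "return_time s B x \<le> n" if "0 < n" "(s ^^ n) x \<in> B" for n
    unfolding return_time_def using that by (intro Least_le) simp
qed

lemma return_time_eqI:
  assumes "0 < m" "(s ^^ m) x \<in> B" "\<And>i. 0 < i \<Longrightarrow> i < m \<Longrightarrow> (s ^^ i) x \<notin> B"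
  shows "return_time s B x = m"
  unfolding return_time_def using assms by (intro Least_equality) (auto simp: not_less[symmetric])

lemma first_return_image:
  assumes "finite A" "s ` A = A" "B \<subseteq> A"
  shows "first_return s B ` B = B"
proof -
  note rt = return_time[OF assms]
  have inj: "inj_on s A" using assms by (simp add: eq_card_imp_inj_on)
  have inA: "(s ^^ n) x \<in> A" if "x \<in> A" for n x
    by (induction n) (use that assms(2) in auto)
  have injn: "(s ^^ n) x = (s ^^ n) y \<longleftrightarrow> x = y" if "x \<in> A" "y \<in> A" for n x y
    by (induction n) (use that inA inj in \<open>auto dest: inj_onD\<close>)
  have *: "x = y" if "x \<in> B" "y \<in> B" "first_return s B x = first_return s B y"
    "return_time s B x \<le> return_time s B y" for x y
  proof -
    let ?m = "return_time s B x" and ?n = "return_time s B y"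
    \<comment> \<open>going back \<open>?m\<close> steps from the common endpoint shows that \<open>x\<close> lies on the path from \<open>y\<close>
      before its return\<close>
    have "(s ^^ ?m) x = (s ^^ ?m) ((s ^^ (?n - ?m)) y)"
      using that(3,4) by (simp add: first_return_def flip: funpow_add comp_apply[of "s ^^ ?m"])
    then have x: "x = (s ^^ (?n - ?m)) y" using injn inA that assms(3) by blast
    then have "?n - ?m = 0"
      using rt(3)[OF that(2), of "?n - ?m"] rt(1)[OF that(1)] rt(1)[OF that(2)] that(1) by fastforce
    then show ?thesis using x by simp
  qed
  have "inj_on (first_return s B) B"
    using * by (intro inj_onI) (metis nat_le_linear)
  moreover have "first_return s B ` B \<subseteq> B" using rt(2) by blast
  moreover have "finite B" using assms finite_subset by blast
  ultimately show ?thesis by (simp add: endo_inj_surj)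
qed

lemma orbit_first_return:
  assumes "finite A" "s ` A = A" "B \<subseteq> A" "x \<in> B"
  shows "orbit (first_return s B) x = orbit s x \<inter> B"
proof (intro equalityI subsetI)
  note rt = return_time[OF assms(1-3)]
  fix y assume "y \<in> orbit (first_return s B) x"
  then show "y \<in> orbit s x \<inter> B"
  proof induction
    case base
    then show ?case using rt[OF assms(4)] by (auto simp: first_return_def orbit_altdef)
  next
    case (step y)
    then show ?case using rt[of y] by (auto simp: first_return_def intro: funpow_in_orbit)
  qed
next
  note rt = return_time[OF assms(1-3)]
  have "(s ^^ n) x \<in> orbit (first_return s B) x" if "0 < n" "(s ^^ n) x \<in> B" for n
    using that assms(4)
  proof (induction n arbitrary: x rule: less_induct)
    case (less n)
    let ?m = "return_time s B x"
    have m: "?m \<le> n" "0 < ?m" using rt less.prems by auto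
    show ?case
    proof (cases "?m = n")
      case True
      then show ?thesis by (metis first_return_def orbit.base)
    next
      case False
      have eq: "(s ^^ (n - ?m)) (first_return s B x) = (s ^^ n) x"
        using m(1) by (simp add: first_return_def flip: funpow_add comp_apply[of "s ^^ (n - ?m)"])
      have "(s ^^ (n - ?m)) (first_return s B x) \<in> orbit (first_return s B) (first_return s B x)"
        using m False less.prems rt(2)[of x] eq by (intro less.IH) auto
      then show ?thesis unfolding eq by (rule orbit_subset)
    qed
  qed
  then show "y \<in> orbit (first_return s B) x" if "y \<in> orbit s x \<inter> B" for y
    using that by (auto simp: orbit_altdef[of s])
qed

text \<open>
  Intersecting with \<open>B\<close> is a bijection from the cycles of \<open>s\<close> that meet \<open>B\<close> to the cycles of the
  first return map.
\<close>

lemma card_cycles_first_return: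
  assumes "finite A" "s ` A = A" "B \<subseteq> A"
  shows "card (cycles_on s A) =
    card (cycles_on (first_return s B) B) + card {c \<in> cycles_on s A. c \<inter> B = {}}"
proof -
  let ?M = "cycles_on s B" and ?N = "{c \<in> cycles_on s A. c \<inter> B = {}}"
  have M: "?M \<subseteq> cycles_on s A" using assms(3) by (auto simp: cycles_on_def)
  have meet: "c \<inter> B \<noteq> {}" if "c \<in> ?M" for c
    using that self_in_orbit[OF assms(1,2)] assms(3) by (auto simp: cycles_on_def)
  have "cycles_on s A = ?M \<union> ?N"
  proof -
    have "c \<in> ?M" if "c \<in> cycles_on s A" "x \<in> c" "x \<in> B" for c x
    proof -
      have "c = orbit s x" using that orbit_eq[OF assms(1,2)] by (auto simp: cycles_on_def)
      then show ?thesis using that by (simp add: cycles_on_def)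
    qed
    then show ?thesis using M by blast
  qed
  moreover have "?M \<inter> ?N = {}" using meet by blast
  moreover have "finite ?M" "finite ?N"
    using assms finite_subset[OF assms(3,1)] by (auto simp: finite_cycles_on)
  ultimately have "card (cycles_on s A) = card ?M + card ?N"
    using card_Un_disjoint by metis
  moreover have "cycles_on (first_return s B) B = (\<lambda>c. c \<inter> B) ` ?M"
    using orbit_first_return[OF assms] by (simp add: cycles_on_def image_image)
  moreover have "inj_on (\<lambda>c. c \<inter> B) ?M"
  proof (rule inj_onI)
    fix c c' assume c: "c \<in> ?M" "c' \<in> ?M" "c \<inter> B = c' \<inter> B"
    then have "c \<inter> c' \<noteq> {}" using meet[of c] by blast
    then show "c = c'" using disjoint_cycles_on[OF assms(1,2)] c M by blast
  qed
  ultimately show ?thesis by (simp add: card_image)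
qed

section \<open>Separating the elements of a set into distinct cycles\<close>

text \<open>
  For the vertex permutation and the boundary edges of a map this is the condition of being fully simple
  (see \<open>simple_unroot\<close>), phrased without the ambient set of darts.
\<close>

definition separates :: "('a \<Rightarrow> 'a) \<Rightarrow> 'a set \<Rightarrow> bool" where
  "separates s B \<longleftrightarrow> (\<forall>b\<in>B. orbit s b \<inter> B = {b})"

text \<open>
  A correction \<open>p\<close> applied after each step of \<open>s\<close> has no effect as long as the path of \<open>b\<close> stays among
  the fixed points of \<open>p\<close>. Used with a permutation \<open>p\<close> of \<open>B\<close> and a path that returns to \<open>B\<close> only at time \<open>m\<close>.
\<close>

lemma funpow_detour:
  fixes t p s :: "'a \<Rightarrow> 'a"
  assumes "\<And>x. t x = p (s x)" "0 < m" "\<And>i. 0 < i \<Longrightarrow> i < m \<Longrightarrow> p ((s ^^ i) b) = (s ^^ i) b"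
  shows "i < m \<Longrightarrow> (t ^^ i) b = (s ^^ i) b" and "(t ^^ m) b = p ((s ^^ m) b)"
proof -
  show *: "(t ^^ i) b = (s ^^ i) b" if "i < m" for i
    using that
  proof (induction i)
    case (Suc i)
    have "(t ^^ Suc i) b = t ((t ^^ i) b)" by simp
    also have "(t ^^ i) b = (s ^^ i) b" using Suc by simp
    finally show ?case by (simp add: assms(1) assms(3)[OF _ Suc.prems, simplified])
  qed simp
  obtain k where "m = Suc k" using assms(2) by (cases m) auto
  then show "(t ^^ m) b = p ((s ^^ m) b)" using arg_cong[OF *[of k], of t] assms(1)[of "(s ^^ k) b"] by simp
qed

text \<open>
  Starting at \<open>b\<close>, the path of \<open>s\<close> avoids \<open>B\<close> until it closes up at \<open>b\<close>; at that moment the correction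
  \<open>\<pi>\<close> acts for the first time and sends it to \<open>\<pi> b\<close>. So a glued permutation remembers how it was glued.
\<close>

lemma first_return_comp:
  assumes "separates s B" "\<pi> permutes B" "b \<in> B"
  shows "first_return (\<pi> \<circ> s) B b = \<pi> b"
proof -
  have "b \<in> orbit s b" using assms by (auto simp: separates_def)
  define m where "m = funpow_dist1 s b b"
  have m: "0 < m" "(s ^^ m) b = b"
    using funpow_dist1_prop[OF \<open>b \<in> orbit s b\<close>] by (simp_all add: m_def)
  have out: "(s ^^ i) b \<notin> B" if "0 < i" "i < m" for i
  proof -
    have "(s ^^ i) b \<noteq> b" using that unfolding m_def by (rule funpow_dist1_least)
    moreover have "(s ^^ i) b \<in> orbit s b" using that by (auto simp: orbit_altdef)
    ultimately show ?thesis using assms by (auto simp: separates_def)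
  qed
  have stay: "\<pi> ((s ^^ i) b) = (s ^^ i) b" if "0 < i" "i < m" for i
    using out[OF that] assms(2) by (simp add: permutes_not_in)
  note same = funpow_detour[where t = "\<pi> \<circ> s", OF comp_apply m(1) stay]
  have last: "((\<pi> \<circ> s) ^^ m) b = \<pi> b" using same(2) m(2) by simp
  have "return_time (\<pi> \<circ> s) B b = m"
    using m(1) last same out assms(2,3) by (intro return_time_eqI) (auto simp: permutes_in_image)
  then show ?thesis using last by (simp add: first_return_def)
qed

text \<open>
  The path of \<open>s\<close> from \<open>b\<close> first meets \<open>B\<close> at \<open>\<pi> b\<close>, and \<open>inv \<pi>\<close> redirects it to \<open>b\<close>.
\<close>

lemma separates_first_return:
  assumes "finite A" "s permutes A" "B \<subseteq> A"
  defines "\<pi> \<equiv> perm_restrict (first_return s B) B"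
  shows "\<pi> permutes B" and "separates (inv \<pi> \<circ> s) B"
proof -
  note A = assms(1) permutes_image[OF assms(2)] assms(3)
  show \<pi>: "\<pi> permutes B"
    unfolding \<pi>_def using first_return_image[OF A] finite_subset[OF assms(3,1)]
    by (intro perm_restrict_permutes)
  show "separates (inv \<pi> \<circ> s) B"
    unfolding separates_def
  proof
    fix b assume b: "b \<in> B"
    note rt = return_time[OF A b]
    let ?m = "return_time s B b" and ?s = "inv \<pi> \<circ> s"
    have out: "(s ^^ i) b \<notin> B" if "0 < i" "i < ?m" for i using rt(3)[of i] that by auto
    have stay: "inv \<pi> ((s ^^ i) b) = (s ^^ i) b" if "0 < i" "i < ?m" for i
      using out[OF that] permutes_inv[OF \<pi>] by (simp add: permutes_not_in)
    note same = funpow_detour[where t = ?s, OF comp_apply rt(1) stay]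
    have "(?s ^^ ?m) b = inv \<pi> (first_return s B b)"
      using same(2) by (simp add: first_return_def)
    also have "first_return s B b = \<pi> b" using b by (simp add: \<pi>_def perm_restrict_simps)
    finally have "(?s ^^ ?m) b = b" by (simp only: permutes_inverses(2)[OF \<pi>])
    then have "orbit ?s b = {(?s ^^ i) b | i. i < ?m}" using rt(1) by (rule orbit_altdef_bounded)
    moreover have "(?s ^^ i) b = (s ^^ i) b" if "i < ?m" for i using same(1) that by blast
    then have "(\<lambda>i. (?s ^^ i) b) ` {..<?m} = (\<lambda>i. (s ^^ i) b) ` {..<?m}" by (intro image_cong) blast+
    ultimately have "orbit ?s b = {(s ^^ i) b | i. i < ?m}" by blast
    moreover have "(s ^^ i) b = b" if "i < ?m" "(s ^^ i) b \<in> B" for i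
      using out[of i] that by (cases "i = 0") auto
    moreover have "b \<in> {(s ^^ i) b | i. i < ?m}" using rt(1) by (auto intro: exI[of _ 0])
    ultimately show "orbit ?s b \<inter> B = {b}" using b by auto
  qed
qed

lemma cycles_avoiding_comp:
  assumes "\<pi> permutes B" "c \<in> cycles_on s A" "c \<inter> B = {}" "finite A" "s ` A = A"
  shows "c \<in> cycles_on (\<pi> \<circ> s) A"
proof -
  obtain x where x: "x \<in> A" "c = orbit s x" using assms(2) by (auto simp: cycles_on_def)
  have "(\<pi> \<circ> s) y = s y" if "y \<in> orbit s x" for y
  proof -
    have "s y \<notin> B" using orbit.step[OF that] assms(3) x(2) by blast
    then show ?thesis using assms(1) by (simp add: permutes_not_in)
  qed
  then have "orbit (\<pi> \<circ> s) x = orbit s x"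
    using self_in_orbit[OF assms(4,5) x(1)] by (intro orbit_cong)
  then show ?thesis using x by (auto simp: cycles_on_def)
qed

text \<open>
  The two permutations have the same cycles away from \<open>B\<close>. By \<open>card_cycles_first_return\<close> the
  cycles meeting \<open>B\<close> are counted by the first return maps, which are the identity for \<open>s\<close> and \<open>\<pi>\<close>
  for \<open>\<pi> \<circ> s\<close>.
\<close>

theorem card_cycles_comp:
  assumes "finite A" "s permutes A" "B \<subseteq> A" "separates s B" "\<pi> permutes B"
  shows "card (cycles_on (\<pi> \<circ> s) A) + card B = card (cycles_on s A) + card (cycles_on \<pi> B)"
proof -
  have \<pi>A: "\<pi> permutes A" using assms(5,3) by (rule permutes_subset)
  have \<pi>s: "(\<pi> \<circ> s) ` A = A" and s: "s ` A = A"
    using permutes_compose[OF assms(2) \<pi>A] assms(2) by (simp_all only: permutes_image)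
  let ?N = "\<lambda>s. {c \<in> cycles_on s A. c \<inter> B = {}}"
  have "?N (\<pi> \<circ> s) = ?N s"
  proof -
    have "inv \<pi> \<circ> (\<pi> \<circ> s) = s" using permutes_inverses(2)[OF \<pi>A] by (simp add: fun_eq_iff)
    then show ?thesis
      using cycles_avoiding_comp[OF assms(5) _ _ assms(1) s]
        cycles_avoiding_comp[OF permutes_inv[OF assms(5)] _ _ assms(1) \<pi>s]
      by auto
  qed
  moreover have "cycles_on (first_return (\<pi> \<circ> s) B) B = cycles_on \<pi> B"
    using first_return_comp[OF assms(4,5)] assms(5)
    by (intro cycles_on_cong) (auto simp: permutes_in_image)
  moreover have "card (cycles_on (first_return s B) B) = card B"
  proof -
    have "cycles_on (first_return s B) B = cycles_on id B"
      using first_return_comp[OF assms(4) permutes_id] by (intro cycles_on_cong) auto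
    moreover have "orbit id x = {x}" for x :: 'a by (simp add: orbit_eq_singleton_iff)
    ultimately show ?thesis by (simp add: cycles_on_def card_image)
  qed
  ultimately show ?thesis
    using card_cycles_first_return[OF assms(1) \<pi>s assms(3)]
      card_cycles_first_return[OF assms(1) s assms(3)] by simp
qed

section \<open>Strictly monotone factorisations\<close>

definition composite :: "('a \<Rightarrow> 'a) list \<Rightarrow> 'a \<Rightarrow> 'a" where
  "composite \<tau>s = foldr (\<circ>) \<tau>s id"

lemma composite_Nil: "composite [] = id"
  by (simp add: composite_def fun_eq_iff)

lemma composite_snoc: "composite (\<tau>s @ [\<tau>]) = composite \<tau>s \<circ> \<tau>"
  unfolding composite_def by (induction \<tau>s) (auto simp: fun_eq_iff)

lemma strictly_monotone_0: "strictly_monotone 0 \<tau>s \<longleftrightarrow> \<tau>s = []"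
proof
  assume "strictly_monotone 0 \<tau>s"
  then show "\<tau>s = []" using strictly_monotone_length by fastforce
qed (simp add: strictly_monotone_def)

lemma strictly_monotone_Suc:
  "strictly_monotone (Suc d) \<tau>s \<longleftrightarrow> strictly_monotone d \<tau>s \<or>
    (\<exists>a\<in>{1..d}. \<exists>\<tau>s'. strictly_monotone d \<tau>s' \<and> \<tau>s = \<tau>s' @ [transpose a (Suc d)])"
  (is "?L \<longleftrightarrow> ?R")
proof
  assume ?L
  then obtain ps where ps: "\<tau>s = map (\<lambda>(a, b). transpose a b) ps"
    "\<forall>(a, b)\<in>set ps. 1 \<le> a \<and> a < b \<and> b \<le> Suc d" "sorted_wrt (<) (map snd ps)"
    by (auto simp: strictly_monotone_def)
  show ?R
  proof (cases ps rule: rev_cases)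
    case Nil
    then show ?thesis using ps(1) by (auto simp: strictly_monotone_def)
  next
    case (snoc qs p)
    obtain a b where p: "p = (a, b)" by force
    have ab: "1 \<le> a" "a < b" "b \<le> Suc d" using ps(2) by (auto simp: snoc p)
    have qs: "1 \<le> x \<and> x < y \<and> y < b" if "(x, y) \<in> set qs" for x y
      using ps(2,3) that by (force simp: snoc p sorted_wrt_append)
    show ?thesis
    proof (cases "b = Suc d")
      case True
      have "strictly_monotone d (map (\<lambda>(a, b). transpose a b) qs)"
        unfolding strictly_monotone_def using qs ps(3) True
        by (intro exI[of _ qs]) (force simp: snoc sorted_wrt_append)
      then show ?thesis using ab ps(1) True by (auto simp: snoc p)
    next
      case False
      then have "\<forall>(x, y)\<in>set ps. 1 \<le> x \<and> x < y \<and> y \<le> d"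
        using qs ab by (force simp: snoc p)
      then show ?thesis using ps unfolding strictly_monotone_def by blast
    qed
  qed
next
  assume ?R
  then show ?L
  proof
    assume "strictly_monotone d \<tau>s"
    then obtain ps where ps: "\<tau>s = map (\<lambda>(a, b). transpose a b) ps"
      "\<forall>(a, b)\<in>set ps. 1 \<le> a \<and> a < b \<and> b \<le> d" "sorted_wrt (<) (map snd ps)"
      unfolding strictly_monotone_def by blast
    have "\<forall>(a, b)\<in>set ps. 1 \<le> a \<and> a < b \<and> b \<le> Suc d" using ps(2) by auto
    then show ?L unfolding strictly_monotone_def using ps(1,3) by blast
  next
    assume "\<exists>a\<in>{1..d}. \<exists>\<tau>s'. strictly_monotone d \<tau>s' \<and> \<tau>s = \<tau>s' @ [transpose a (Suc d)]"
    then obtain a \<tau>s' where a: "a \<in> {1..d}" "\<tau>s = \<tau>s' @ [transpose a (Suc d)]"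
      and "strictly_monotone d \<tau>s'"
      by blast
    then obtain ps where ps: "\<tau>s' = map (\<lambda>(a, b). transpose a b) ps"
      "\<forall>(a, b)\<in>set ps. 1 \<le> a \<and> a < b \<and> b \<le> d" "sorted_wrt (<) (map snd ps)"
      unfolding strictly_monotone_def by blast
    let ?qs = "ps @ [(a, Suc d)]"
    have "\<tau>s = map (\<lambda>(a, b). transpose a b) ?qs" using a(2) ps(1) by simp
    moreover have "\<forall>(a, b)\<in>set ?qs. 1 \<le> a \<and> a < b \<and> b \<le> Suc d" using ps(2) a(1) by auto
    moreover have "sorted_wrt (<) (map snd ?qs)" using ps(2,3) by (fastforce simp: sorted_wrt_append)
    ultimately show ?L unfolding strictly_monotone_def by blast
  qed
qed

lemma card_cycles_insert_fixed:
  assumes "finite A" "f ` A = A" "f b = b" "b \<notin> A"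
  shows "card (cycles_on f (insert b A)) = Suc (card (cycles_on f A))"
proof -
  have "orbit f b = {b}" using assms(3) by (simp add: orbit_eq_singleton_iff)
  then have "cycles_on f (insert b A) = insert {b} (cycles_on f A)"
    by (simp add: cycles_on_def)
  moreover have "{b} \<notin> cycles_on f A"
    using orbit_subset_invariant[OF assms(2)] assms(4) by (fastforce simp: cycles_on_def)
  ultimately show ?thesis using assms(1) by (simp add: finite_cycles_on)
qed

text \<open>
  Moving the transposition to the left turns this into a gluing along \<open>{f a, b}\<close>: the permutation
  \<open>f\<close> separates \<open>f a\<close> from its fixed point \<open>b\<close>, and \<open>card_cycles_comp\<close> applies.
\<close>

lemma card_cycles_join:
  assumes "finite A" "f permutes A" "a \<in> A" "b \<notin> A"
  shows "card (cycles_on (f \<circ> transpose a b) (insert b A)) = card (cycles_on f A)"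
proof -
  let ?A = "insert b A" and ?a = "f a"
  let ?B = "{?a, b}" and ?\<tau> = "transpose (f a) b"
  have fb: "f b = b" using assms(2,4) by (simp add: permutes_not_in)
  have fA: "f ` A = A" using assms(2) by (rule permutes_image)
  have a: "?a \<in> A" using assms(2,3) by (simp add: permutes_in_image)
  \<comment> \<open>conjugating the transposition by \<open>f\<close>, which fixes \<open>b\<close>\<close>
  have "f \<circ> transpose a b = ?\<tau> \<circ> f"
  proof -
    have "inv f ?a = a" "inv f b = b"
      using permutes_inverses(2)[OF assms(2)] fb by metis+
    then show ?thesis using transpose_comp_eq[OF permutes_bij[OF assms(2)], of ?a b] by simp
  qed
  moreover have "card (cycles_on (?\<tau> \<circ> f) ?A) + card ?B = card (cycles_on f ?A) + card (cycles_on ?\<tau> ?B)"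
  proof (rule card_cycles_comp)
    have "orbit f b = {b}" using fb by (simp add: orbit_eq_singleton_iff)
    moreover have "orbit f ?a \<inter> ?B = {?a}"
      using self_in_orbit[OF assms(1) fA a] orbit_subset_invariant[OF fA a] assms(4) by auto
    ultimately show "separates f ?B" using a assms(4) by (auto simp: separates_def)
    show "f permutes ?A" using assms(2) by (rule permutes_subset) auto
    show "?\<tau> permutes ?B" by (rule permutes_swap_id) auto
  qed (use assms(1) a in auto)
  moreover have "card (cycles_on ?\<tau> ?B) = 1"
  proof -
    have \<tau>B: "?\<tau> ` ?B = ?B" by auto
    have "b \<in> orbit ?\<tau> ?a" using orbit.base[of ?\<tau> ?a] by simp
    then have "orbit ?\<tau> b = orbit ?\<tau> ?a" by (intro orbit_eq[OF _ \<tau>B]) auto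
    then show ?thesis by (simp add: cycles_on_def)
  qed
  moreover have "card ?B = 2" using a assms(4) by (metis card_2_iff)
  ultimately show ?thesis
    using card_cycles_insert_fixed[OF assms(1) fA fb assms(4)] by simp
qed

text \<open>
  The largest element \<open>d\<close> of the ground set occurs at most in the last transposition, which then joins
  it to a cycle of the product of the others.
\<close>

theorem strictly_monotone_product:
  assumes "strictly_monotone d \<tau>s"
  shows "composite \<tau>s permutes {1..d}"
    and "length \<tau>s + card (cycles_on (composite \<tau>s) {1..d}) = d"
proof -
  have "composite \<tau>s permutes {1..d} \<and>
      length \<tau>s + card (cycles_on (composite \<tau>s) {1..d}) = d"
    using assms
  proof (induction d arbitrary: \<tau>s)
    case 0
    then show ?case by (simp add: strictly_monotone_0 cycles_on_def composite_Nil fun_eq_iff)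
  next
    case (Suc d)
    have A: "{1..Suc d} = insert (Suc d) {1..d}" by (simp add: atLeastAtMostSuc_conv)
    from Suc.prems consider "strictly_monotone d \<tau>s"
      | a \<tau>s' where "a \<in> {1..d}" "strictly_monotone d \<tau>s'" "\<tau>s = \<tau>s' @ [transpose a (Suc d)]"
      by (auto simp: strictly_monotone_Suc)
    then show ?case
    proof cases
      case 1
      let ?p = "composite \<tau>s"
      have p: "?p permutes {1..d}" "length \<tau>s + card (cycles_on ?p {1..d}) = d"
        using Suc.IH[OF 1] by auto
      have "?p (Suc d) = Suc d" using p(1) by (simp add: permutes_not_in)
      then have "card (cycles_on ?p {1..Suc d}) = Suc (card (cycles_on ?p {1..d}))"
        unfolding A using permutes_image[OF p(1)] by (intro card_cycles_insert_fixed) auto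
      moreover have "?p permutes {1..Suc d}" using p(1) by (rule permutes_subset) auto
      ultimately show ?thesis using p(2) by simp
    next
      case 2
      let ?p = "composite \<tau>s'"
      have p: "?p permutes {1..d}" "length \<tau>s' + card (cycles_on ?p {1..d}) = d"
        using Suc.IH[OF 2(2)] by auto
      have prod: "composite \<tau>s = ?p \<circ> transpose a (Suc d)"
        unfolding 2(3) by (rule composite_snoc)
      have "card (cycles_on (?p \<circ> transpose a (Suc d)) {1..Suc d}) = card (cycles_on ?p {1..d})"
        unfolding A using p(1) 2(1) by (intro card_cycles_join) auto
      moreover have "?p \<circ> transpose a (Suc d) permutes {1..Suc d}"
        using 2(1) permutes_subset[OF p(1), of "{1..Suc d}"]
        by (intro permutes_compose permutes_swap_id) auto
      moreover have "length \<tau>s = Suc (length \<tau>s')" using 2(3) by simp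
      ultimately show ?thesis using p(2) prod by (metis add_Suc)
    qed
  qed
  then show "composite \<tau>s permutes {1..d}"
    "length \<tau>s + card (cycles_on (composite \<tau>s) {1..d}) = d" by auto
qed

lemma permutes_drop_fixed:
  assumes "\<pi> permutes {1..Suc d}" "\<pi> (Suc d) = Suc d"
  shows "\<pi> permutes {1..d}"
  using assms(1) by (rule permutes_superset) (use assms(2) le_Suc_eq in auto)

text \<open>
  The last factor is forced: if \<open>\<pi>\<close> moves the largest element \<open>d\<close>, then \<open>d\<close> must occur in it, and
  its partner is \<open>inv \<pi> d\<close> because the earlier factors fix \<open>d\<close>. If \<open>\<pi>\<close> fixes \<open>d\<close>, then \<open>d\<close>
  occurs in no factor.
\<close>

theorem strictly_monotone_factorisation:
  assumes "\<pi> permutes {1..d}"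
  shows "\<exists>!\<tau>s. strictly_monotone d \<tau>s \<and> composite \<tau>s = \<pi>"
  using assms
proof (induction d arbitrary: \<pi>)
  case 0
  then show ?case by (intro ex1I[of _ "[]"]) (simp_all add: strictly_monotone_0 composite_Nil)
next
  case (Suc d)
  let ?b = "Suc d"
  have fixes_b: "composite \<tau>s ?b = ?b" if "strictly_monotone d \<tau>s" for \<tau>s
    using strictly_monotone_product(1)[OF that] by (simp add: permutes_not_in)
  have moves_b: "(composite (\<tau>s @ [transpose a ?b])) ?b \<noteq> ?b"
    "(composite (\<tau>s @ [transpose a ?b])) a = ?b"
    if "strictly_monotone d \<tau>s" "a \<in> {1..d}" for \<tau>s a
  proof -
    have "composite \<tau>s a \<in> {1..d}"
      using that strictly_monotone_product(1)[OF that(1)] by (simp only: permutes_in_image)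
    then show "(composite (\<tau>s @ [transpose a ?b])) ?b \<noteq> ?b"
      "(composite (\<tau>s @ [transpose a ?b])) a = ?b"
      using fixes_b[OF that(1)] by (simp_all only: composite_snoc) auto
  qed
  show ?case
  proof (cases "\<pi> ?b = ?b")
    case True
    have "strictly_monotone ?b \<tau>s \<and> composite \<tau>s = \<pi> \<longleftrightarrow>
        strictly_monotone d \<tau>s \<and> composite \<tau>s = \<pi>" for \<tau>s
      using moves_b(1) True by (auto simp: strictly_monotone_Suc)
    then show ?thesis using Suc.IH[OF permutes_drop_fixed[OF Suc.prems True]] by simp
  next
    case False
    define a where "a = inv \<pi> ?b"
    have \<pi>a: "\<pi> a = ?b" using permutes_inverses(1)[OF Suc.prems] by (simp add: a_def)
    then have "a \<in> {1..Suc d}" using Suc.prems permutes_in_image[OF Suc.prems, of a] by simp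
    then have a: "a \<in> {1..d}" using \<pi>a False le_Suc_eq by auto
    let ?t = "transpose a ?b"
    have "\<pi> \<circ> ?t permutes {1..d}"
    proof (rule permutes_drop_fixed)
      show "\<pi> \<circ> ?t permutes {1..Suc d}"
        using Suc.prems a by (intro permutes_compose permutes_swap_id) auto
    qed (simp add: \<pi>a)
    then obtain \<sigma>s where \<sigma>s: "strictly_monotone d \<sigma>s" "composite \<sigma>s = \<pi> \<circ> ?t"
      and uniq: "\<And>\<tau>s. strictly_monotone d \<tau>s \<Longrightarrow> composite \<tau>s = \<pi> \<circ> ?t \<Longrightarrow> \<tau>s = \<sigma>s"
      using Suc.IH by blast
    have tt: "f \<circ> ?t \<circ> ?t = f" for f :: "nat \<Rightarrow> nat"
      by (simp add: fun_eq_iff)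
    show ?thesis
    proof (rule ex1I[of _ "\<sigma>s @ [?t]"])
      show "strictly_monotone ?b (\<sigma>s @ [?t]) \<and> composite (\<sigma>s @ [?t]) = \<pi>"
        using \<sigma>s a unfolding composite_snoc strictly_monotone_Suc by (metis tt)
      fix \<tau>s assume \<tau>s: "strictly_monotone ?b \<tau>s \<and> composite \<tau>s = \<pi>"
      then have "\<not> strictly_monotone d \<tau>s" using fixes_b False by metis
      then obtain a' \<tau>s' where a': "a' \<in> {1..d}" "strictly_monotone d \<tau>s'"
        "\<tau>s = \<tau>s' @ [transpose a' ?b]"
        using \<tau>s by (auto simp: strictly_monotone_Suc)
      have "\<pi> a' = ?b" using moves_b(2)[OF a'(2,1)] \<tau>s a'(3) by simp
      then have "a' = a" using \<pi>a permutes_inj[OF Suc.prems] by (metis injD)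
      moreover have "composite \<tau>s' \<circ> transpose a' ?b = \<pi>"
        using \<tau>s unfolding a'(3) composite_snoc by simp
      ultimately have "composite \<tau>s' = \<pi> \<circ> ?t" using tt[of "composite \<tau>s'"] by simp
      then show "\<tau>s = \<sigma>s @ [?t]" using uniq[OF a'(2)] a'(3) \<open>a' = a\<close> by simp
    qed
  qed
qed

section \<open>Strictly monotone Hurwitz numbers as a sum over permutations\<close>

text \<open>
  The weighted number of gluings of a fully simple map with boundary edges \<open>A\<close> and face permutation
  \<open>g\<close> into maps whose boundary faces have degrees \<open>\<nu>\<close>. The exponent of \<open>\<hbar>\<close> is the
  decrease of the number of vertices.
\<close>

definition reglue_sum :: "('a \<Rightarrow> 'a) \<Rightarrow> 'a set \<Rightarrow> nat list \<Rightarrow> laurent" where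
  "reglue_sum g A \<nu> = (\<Sum>\<pi> | \<pi> permutes A \<and> cycle_type (g \<circ> inv \<pi>) A = mset \<nu>.
     Poly_Mapping.single (int (card A) - int (card (cycles_on \<pi> A))) 1)"

lemma permutes_inv_image:
  assumes "\<pi> permutes A" "x \<in> A"
  shows "inv \<pi> x \<in> A"
  using permutes_in_image[OF permutes_inv[OF assms(1)]] assms(2) by simp

lemma reglue_sum_transport:
  assumes g: "g ` A = A" and fin: "finite A" and bij: "bij_betw \<phi> A A'"
    and c: "\<And>x. x \<in> A \<Longrightarrow> g' (\<phi> x) = \<phi> (g x)"
  shows "reglue_sum g' A' \<nu> = reglue_sum g A \<nu>"
proof -
  define T where "T = (\<lambda>\<pi> x. if x \<in> A' then \<phi> (\<pi> (inv_into A \<phi> x)) else x)"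
  have T: "bij_betw T {\<pi>. \<pi> permutes A} {\<pi>. \<pi> permutes A'}"
    unfolding T_def by (rule bij_betw_permutations[OF bij])
  have A': "\<phi> x \<in> A'" if "x \<in> A" for x using bij that by (auto simp: bij_betw_def)
  have T\<phi>: "T \<pi> (\<phi> x) = \<phi> (\<pi> x)" if "x \<in> A" for \<pi> x
    using that A' bij_betw_inv_into_left[OF bij that] by (simp add: T_def)
  have Tp: "T \<pi> permutes A'" if "\<pi> permutes A" for \<pi>
    using T that by (auto simp: bij_betw_def)
  have cyc: "card (cycles_on (T \<pi>) A') = card (cycles_on \<pi> A)" if "\<pi> permutes A" for \<pi>
    using T\<phi> by (rule cycle_type_transport(2)[OF permutes_image[OF that] fin bij])
  have inv: "inv (T \<pi>) (\<phi> x) = \<phi> (inv \<pi> x)" if "\<pi> permutes A" "x \<in> A" for \<pi> x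
  proof -
    have "T \<pi> (\<phi> (inv \<pi> x)) = \<phi> x"
      using T\<phi>[OF permutes_inv_image[OF that]] permutes_inverses(1)[OF that(1)] by simp
    then show ?thesis using permutes_inv_eq[OF Tp[OF that(1)]] by simp
  qed
  have type: "cycle_type (g' \<circ> inv (T \<pi>)) A' = cycle_type (g \<circ> inv \<pi>) A" if \<pi>: "\<pi> permutes A" for \<pi>
  proof (rule cycle_type_transport(1)[OF _ fin bij])
    have "inv \<pi> ` A = A" using permutes_inv[OF \<pi>] by (rule permutes_image)
    then show "(g \<circ> inv \<pi>) ` A = A" using g by (metis image_comp)
    show "(g' \<circ> inv (T \<pi>)) (\<phi> x) = \<phi> ((g \<circ> inv \<pi>) x)" if "x \<in> A" for x
      using inv[OF \<pi> that] c[OF permutes_inv_image[OF \<pi> that]] by simp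
  qed
  have T': "bij_betw T {\<pi>. \<pi> permutes A \<and> cycle_type (g \<circ> inv \<pi>) A = mset \<nu>}
      {\<pi>. \<pi> permutes A' \<and> cycle_type (g' \<circ> inv \<pi>) A' = mset \<nu>}"
  proof (rule bij_betw_subset[OF T, of "{\<pi>. \<pi> permutes A \<and> cycle_type (g \<circ> inv \<pi>) A = mset \<nu>}", THEN
        bij_betw_cong[THEN iffD1, rotated]], goal_cases)
    case 1 then show ?case by blast
  next
    case 2
    have "T ` {\<pi>. \<pi> permutes A} = {\<pi>. \<pi> permutes A'}" using T by (simp add: bij_betw_def)
    then show ?case using type by (auto simp: image_iff set_eq_iff) metis
  qed simp
  show ?thesis
    unfolding reglue_sum_def sum.reindex_bij_betw[symmetric, OF T']
    using bij_betw_same_card[OF bij] cyc by (intro sum.cong) auto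
qed

text \<open>
  The product condition determines the first permutation of a tuple from the others, and the
  transpositions amount to the choice of their product \<open>\<pi>\<close>, whose number of cycles fixes \<open>k\<close>.
\<close>

lemma card_hurwitz_tuples:
  "card (hurwitz_tuples d k \<nu> \<mu>) =
    card {(\<rho>, \<pi>). \<rho> permutes {1..d} \<and> cycle_type \<rho> {1..d} = mset \<mu> \<and> \<pi> permutes {1..d} \<and>
      cycle_type (inv \<rho> \<circ> inv \<pi>) {1..d} = mset \<nu> \<and> k + card (cycles_on \<pi> {1..d}) = d}"
  (is "_ = card ?S")
proof -
  let ?f = "\<lambda>(\<sigma> :: nat \<Rightarrow> nat, \<tau>s, \<rho> :: nat \<Rightarrow> nat). (\<rho>, composite \<tau>s)"
  have solve: "\<sigma> \<circ> \<pi> \<circ> \<rho> = id \<longleftrightarrow> \<sigma> = inv \<rho> \<circ> inv \<pi>"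
    if "\<pi> permutes {1..d}" "\<rho> permutes {1..d}" for \<sigma> \<pi> \<rho> :: "nat \<Rightarrow> nat"
  proof
    assume "\<sigma> \<circ> \<pi> \<circ> \<rho> = id"
    then have "\<sigma> (\<pi> (\<rho> x)) = x" for x by (metis comp_apply id_apply)
    from this[of "inv \<rho> (inv \<pi> x)" for x] show "\<sigma> = inv \<rho> \<circ> inv \<pi>"
      using permutes_inverses(1)[OF that(1)] permutes_inverses(1)[OF that(2)]
      by (simp add: fun_eq_iff)
  next
    assume "\<sigma> = inv \<rho> \<circ> inv \<pi>"
    then show "\<sigma> \<circ> \<pi> \<circ> \<rho> = id"
      using permutes_inverses(2)[OF that(1)] permutes_inverses(2)[OF that(2)]
      by (simp add: fun_eq_iff)
  qed
  have mem: "(\<sigma>, \<tau>s, \<rho>) \<in> hurwitz_tuples d k \<nu> \<mu> \<longleftrightarrow>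
      strictly_monotone d \<tau>s \<and> \<sigma> = inv \<rho> \<circ> inv (composite \<tau>s) \<and> (\<rho>, composite \<tau>s) \<in> ?S"
    for \<sigma> \<tau>s \<rho>
  proof (cases "strictly_monotone d \<tau>s \<and> \<rho> permutes {1..d}")
    case True
    note prod = strictly_monotone_product[OF conjunct1[OF True]]
    have "inv \<rho> \<circ> inv (composite \<tau>s) permutes {1..d}"
      using True prod(1) by (intro permutes_compose permutes_inv) auto
    moreover have "length \<tau>s = k \<longleftrightarrow> k + card (cycles_on (composite \<tau>s) {1..d}) = d"
      using prod(2) by auto
    ultimately show ?thesis
      using True prod(1) solve[OF prod(1) conjunct2[OF True], of \<sigma>]
      unfolding hurwitz_tuples_def composite_def by auto
  next
    case False
    then show ?thesis by (auto simp: hurwitz_tuples_def)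
  qed
  have inj: "inj_on ?f (hurwitz_tuples d k \<nu> \<mu>)"
  proof (rule inj_onI)
    fix p q assume p: "p \<in> hurwitz_tuples d k \<nu> \<mu>" and q: "q \<in> hurwitz_tuples d k \<nu> \<mu>" and eq: "?f p = ?f q"
    obtain \<sigma> \<tau>s \<rho> where p': "p = (\<sigma>, \<tau>s, \<rho>)" by (metis prod_cases3)
    obtain \<sigma>' \<tau>s' \<rho>' where q': "q = (\<sigma>', \<tau>s', \<rho>')" by (metis prod_cases3)
    have sm: "strictly_monotone d \<tau>s" "strictly_monotone d \<tau>s'"
      "\<sigma> = inv \<rho> \<circ> inv (composite \<tau>s)" "\<sigma>' = inv \<rho>' \<circ> inv (composite \<tau>s')"
      using p q unfolding p' q' mem by blast+
    have e: "\<rho> = \<rho>'" "composite \<tau>s = composite \<tau>s'" using eq p' q' by auto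
    then have "\<tau>s = \<tau>s'"
      using strictly_monotone_factorisation[OF strictly_monotone_product(1)[OF sm(1)]] sm(1,2) by metis
    then show "p = q" unfolding p' q' sm(3,4) e(1) by simp
  qed
  have img: "?f ` hurwitz_tuples d k \<nu> \<mu> = ?S"
  proof (intro equalityI subsetI)
    fix x assume "x \<in> ?f ` hurwitz_tuples d k \<nu> \<mu>"
    then obtain \<sigma> \<tau>s \<rho> where "(\<sigma>, \<tau>s, \<rho>) \<in> hurwitz_tuples d k \<nu> \<mu>" "x = (\<rho>, composite \<tau>s)" by auto
    then show "x \<in> ?S" using mem by blast
  next
    fix x assume x: "x \<in> ?S"
    then obtain \<rho> \<pi> where x': "x = (\<rho>, \<pi>)" "\<pi> permutes {1..d}" by blast
    obtain \<tau>s where \<tau>s: "strictly_monotone d \<tau>s" "composite \<tau>s = \<pi>"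
      using strictly_monotone_factorisation[OF x'(2)] by blast
    have "(inv \<rho> \<circ> inv \<pi>, \<tau>s, \<rho>) \<in> hurwitz_tuples d k \<nu> \<mu>"
      using mem \<tau>s x x'(1) by blast
    then show "x \<in> ?f ` hurwitz_tuples d k \<nu> \<mu>"
      using \<tau>s(2) x'(1) by (intro image_eqI[where x = "(inv \<rho> \<circ> inv \<pi>, \<tau>s, \<rho>)"]) auto
  qed
  show ?thesis using card_image[OF inj] unfolding img by simp
qed

lemma card_cycles_le:
  assumes "finite A"
  shows "card (cycles_on f A) \<le> card A"
  unfolding cycles_on_def using assms by (rule card_image_le)

lemma hurwitz_series_reglue_sum:
  "hurwitz_series d \<nu> \<mu> = (\<Sum>\<rho> | \<rho> permutes {1..d} \<and> cycle_type \<rho> {1..d} = mset \<mu>.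
     Poly_Mapping.single 0 (1 / fact d) * reglue_sum (inv \<rho>) {1..d} \<nu>)"
proof -
  let ?A = "{1..d}"
  let ?C = "{\<rho>. \<rho> permutes ?A \<and> cycle_type \<rho> ?A = mset \<mu>}"
  let ?D = "\<lambda>\<rho>. {\<pi>. \<pi> permutes ?A \<and> cycle_type (inv \<rho> \<circ> inv \<pi>) ?A = mset \<nu>}"
  let ?S = "SIGMA \<rho> : ?C. ?D \<rho>"
  let ?k = "\<lambda>\<pi>. d - card (cycles_on \<pi> ?A)"
  let ?w = "\<lambda>j. Poly_Mapping.single (int j) (1 / fact d) :: laurent"
  have le: "card (cycles_on \<pi> ?A) \<le> d" for \<pi> using card_cycles_le[of ?A \<pi>] by simp
  have finC: "finite ?C" and finD: "finite (?D \<rho>)" for \<rho>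
    by (simp_all add: finite_permutations)
  then have finS: "finite ?S" by (intro finite_SigmaI)
  have level: "Poly_Mapping.single (int k) (hurwitz_number d k \<nu> \<mu>) =
      (\<Sum>p | p \<in> ?S \<and> ?k (snd p) = k. ?w (?k (snd p)))" if "k \<in> {..d}" for k
  proof -
    let ?Sk = "{p. p \<in> ?S \<and> ?k (snd p) = k}"
    have "(\<Sum>p\<in>?Sk. ?w (?k (snd p))) = (\<Sum>p\<in>?Sk. ?w k)" by (intro sum.cong) auto
    also have "\<dots> = of_nat (card ?Sk) * ?w k" by simp
    also have "\<dots> = Poly_Mapping.single (int k) (of_nat (card ?Sk) * (1 / fact d))"
      unfolding single_of_nat[symmetric] mult_single by simp
    also have "card ?Sk = card (hurwitz_tuples d k \<nu> \<mu>)"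
    proof -
      have "d - c = k \<longleftrightarrow> k + c = d" if "c \<le> d" for c using \<open>k \<in> {..d}\<close> that by auto
      then have k: "?k \<pi> = k \<longleftrightarrow> k + card (cycles_on \<pi> ?A) = d" for \<pi> using le by blast
      show ?thesis
        unfolding card_hurwitz_tuples k by (rule arg_cong[of _ _ card]) fastforce
    qed
    finally show ?thesis
      by (simp only: hurwitz_number_def times_divide_eq_right mult_1_right)
  qed
  have "hurwitz_series d \<nu> \<mu> = (\<Sum>k\<le>d. Poly_Mapping.single (int k) (hurwitz_number d k \<nu> \<mu>))"
    unfolding hurwitz_series_def
  proof (rule Sum_any.expand_superset)
    have "k \<le> d" if "p \<in> hurwitz_tuples d k \<nu> \<mu>" for k p
      using that strictly_monotone_length[of d "fst (snd p)"] by (auto simp: hurwitz_tuples_def)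
    then have "hurwitz_tuples d k \<nu> \<mu> = {}" if "k > d" for k
      using that by (meson equals0I not_le)
    then have "hurwitz_number d k \<nu> \<mu> = 0" if "k > d" for k
      using that by (simp add: hurwitz_number_def)
    then have zero: "Poly_Mapping.single (int k) (hurwitz_number d k \<nu> \<mu>) = 0" if "k > d" for k
      using that by simp
    show "{k. Poly_Mapping.single (int k) (hurwitz_number d k \<nu> \<mu>) \<noteq> 0} \<subseteq> {..d}"
    proof
      fix k assume "k \<in> {k. Poly_Mapping.single (int k) (hurwitz_number d k \<nu> \<mu>) \<noteq> 0}"
      then have "\<not> d < k" using zero[of k] by blast
      then show "k \<in> {..d}" by simp
    qed
  qed simp
  also have "\<dots> = (\<Sum>k\<le>d. \<Sum>p | p \<in> ?S \<and> ?k (snd p) = k. ?w (?k (snd p)))"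
    using level by (rule sum.cong[OF refl])
  also have "\<dots> = (\<Sum>p\<in>?S. ?w (?k (snd p)))"
    by (rule sum.group[OF finS]) auto
  also have "\<dots> = (\<Sum>\<rho>\<in>?C. \<Sum>\<pi>\<in>?D \<rho>. ?w (?k \<pi>))"
    using finC finD by (subst sum.Sigma) (auto simp: case_prod_beta)
  also have "\<dots> = (\<Sum>\<rho>\<in>?C. Poly_Mapping.single 0 (1 / fact d) * reglue_sum (inv \<rho>) ?A \<nu>)"
  proof (intro sum.cong refl)
    fix \<rho>
    show "(\<Sum>\<pi>\<in>?D \<rho>. ?w (?k \<pi>)) = Poly_Mapping.single 0 (1 / fact d) * reglue_sum (inv \<rho>) ?A \<nu>"
      unfolding reglue_sum_def sum_distrib_left mult_single
      by (intro sum.cong refl) (simp add: of_nat_diff le[simplified])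
  qed
  finally show ?thesis .
qed

text \<open>
  In \<open>hurwitz_series_reglue_sum\<close> every \<open>inv \<rho>\<close> is conjugate to \<open>g\<close>, so all summands
  agree with the sum for \<open>g\<close> divided by \<open>d!\<close>, and \<open>card_conjugacy_class\<close> counts them.
\<close>

theorem reglue_sum_hurwitz:
  assumes fin: "finite A" and g: "g ` A = A" and type: "cycle_type g A = mset \<mu>"
  shows "reglue_sum g A \<nu> = of_nat (z_partition \<mu>) * hurwitz_series (card A) \<nu> \<mu>"
proof -
  let ?d = "card A"
  let ?C = "{\<rho>. \<rho> permutes {1..?d} \<and> cycle_type \<rho> {1..?d} = mset \<mu>}"
  obtain \<phi> where \<phi>: "bij_betw \<phi> A {1..?d}" using fin by (metis finite_same_card_bij card_atLeastAtMost diff_Suc_1 finite_atLeastAtMost)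
  define \<rho> where "\<rho> = (\<lambda>x. if x \<in> {1..?d} then \<phi> (perm_restrict g A (inv_into A \<phi> x)) else x)"
  have \<rho>: "\<rho> permutes {1..?d}"
    unfolding \<rho>_def by (rule permutes_bij_inv_into[OF perm_restrict_permutes[OF fin g] \<phi>])
  have "\<rho> (\<phi> x) = \<phi> (g x)" if "x \<in> A" for x
    using that \<phi> bij_betw_inv_into_left[OF \<phi> that] by (auto simp: \<rho>_def perm_restrict_simps bij_betw_def)
  then have "cycle_type \<rho> {1..?d} = mset \<mu>"
    using cycle_type_transport(1)[OF g fin \<phi>] type by metis
  then have card: "card ?C * z_partition \<mu> = fact ?d"
    using card_conjugacy_class[OF _ \<rho>] by simp
  have same: "reglue_sum (inv \<sigma>) {1..?d} \<nu> = reglue_sum g A \<nu>" if "\<sigma> \<in> ?C" for \<sigma>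
  proof -
    have \<sigma>: "inv \<sigma> ` {1..?d} = {1..?d}" "cycle_type (inv \<sigma>) {1..?d} = cycle_type g A"
      using that cycle_type_inv[of "{1..?d}" \<sigma>] type permutes_image[OF permutes_inv[of \<sigma>]] by auto
    then obtain \<psi> where "bij_betw \<psi> A {1..?d}" "\<forall>x\<in>A. \<psi> (g x) = inv \<sigma> (\<psi> x)"
      using cycle_type_intertwiner[OF fin g _ \<sigma>(1)] by auto
    then show ?thesis using reglue_sum_transport[OF g fin] by metis
  qed
  have "hurwitz_series ?d \<nu> \<mu> = (\<Sum>\<sigma>\<in>?C. Poly_Mapping.single 0 (1 / fact ?d) * reglue_sum g A \<nu>)"
    unfolding hurwitz_series_reglue_sum by (intro sum.cong refl) (simp only: same)
  also have "\<dots> = of_nat (card ?C) * (Poly_Mapping.single 0 (1 / fact ?d) * reglue_sum g A \<nu>)"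
    by simp
  finally have "of_nat (z_partition \<mu>) * hurwitz_series ?d \<nu> \<mu> =
      of_nat (z_partition \<mu>) * of_nat (card ?C) * Poly_Mapping.single 0 (1 / fact ?d) * reglue_sum g A \<nu>"
    by (simp only: mult.assoc)
  also have "of_nat (z_partition \<mu>) * of_nat (card ?C) * Poly_Mapping.single 0 (1 / fact ?d) = (1 :: laurent)"
  proof -
    have "of_nat (z_partition \<mu>) * of_nat (card ?C) = (of_nat (fact ?d) :: laurent)"
      unfolding card[symmetric] by (simp only: of_nat_mult mult.commute)
    then show ?thesis
      by (simp only: single_of_nat[symmetric] mult_single) simp
  qed
  finally show ?thesis by simp
qed

section \<open>Counting maps by their labellings\<close>

lemma rmap_eqI:
  assumes "is_map M'" "is_map M''" "darts M' = darts M''" "map_iso \<phi> M M'" "map_iso \<phi> M M''"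
  shows "M' = (M'' :: 'a rmap)"
proof (rule rmap.equality)
  have im: "y \<in> \<phi> ` darts M" if "y \<in> darts M'" for y
    using assms(4) that by (auto simp: map_iso_def bij_betw_def)
  have "\<sigma>0 M' y = \<sigma>0 M'' y \<and> \<sigma>1 M' y = \<sigma>1 M'' y \<and> \<sigma>2 M' y = \<sigma>2 M'' y" for y
  proof (cases "y \<in> darts M'")
    case True
    then show ?thesis using im[OF True] assms(4,5) by (auto simp: map_iso_def)
  next
    case False
    have p: "\<sigma>0 M' permutes darts M'" "\<sigma>1 M' permutes darts M'" "\<sigma>2 M' permutes darts M'"
      "\<sigma>0 M'' permutes darts M'" "\<sigma>1 M'' permutes darts M'" "\<sigma>2 M'' permutes darts M'"
      using assms(1-3) by (auto simp: is_map_def)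
    show ?thesis using p[THEN permutes_not_in, OF False] by simp
  qed
  then show "\<sigma>0 M' = \<sigma>0 M''" "\<sigma>1 M' = \<sigma>1 M''" "\<sigma>2 M' = \<sigma>2 M''" by auto
  show "roots M' = roots M''" using assms(4,5) by (simp add: map_iso_def)
qed (use assms(3) in auto)

lemma map_iso_inv_permutes:
  assumes "map_iso \<phi> M M'" "is_map M" "\<phi> permutes darts M" "darts M' = darts M"
  shows "map_iso (inv \<phi>) M' M"
proof -
  have "\<sigma>0 M (inv \<phi> y) = inv \<phi> (\<sigma>0 M' y) \<and> \<sigma>1 M (inv \<phi> y) = inv \<phi> (\<sigma>1 M' y) \<and>
      \<sigma>2 M (inv \<phi> y) = inv \<phi> (\<sigma>2 M' y)" if "y \<in> darts M" for y
  proof -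
    have x: "inv \<phi> y \<in> darts M" "\<phi> (inv \<phi> y) = y"
      using permutes_inv_image[OF assms(3) that] permutes_inverses(1)[OF assms(3)] by auto
    then show ?thesis
      using assms(1) permutes_inverses(2)[OF assms(3)] unfolding map_iso_def by metis
  qed
  moreover have "map (inv \<phi>) (roots M') = roots M"
  proof -
    have "roots M' = map \<phi> (roots M)" using assms(1) by (simp add: map_iso_def)
    then show ?thesis using permutes_inverses(2)[OF assms(3)] by (simp add: o_def)
  qed
  ultimately show ?thesis
    using permutes_imp_bij[OF permutes_inv[OF assms(3)]] assms(4) by (simp add: map_iso_def)
qed

text \<open>
  This is the orbit-stabiliser theorem: relabelling the darts by a permutation gives another map on the same
  darts, and two relabellings coincide exactly when they differ by an automorphism.
\<close>

lemma card_labellings: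
  fixes M :: "'a rmap"
  assumes M: "is_map M"
  defines "L \<equiv> {M'. is_map M' \<and> darts M' = darts M \<and> (\<exists>\<phi>. map_iso \<phi> M M')}"
  shows "card L * card (Aut M) = fact (card (darts M))"
proof -
  let ?D = "darts M"
  let ?P = "{\<phi>. \<phi> permutes ?D}"
  have fin: "finite ?D" using M by (simp add: is_map_def)
  have "\<exists>M'. is_map M' \<and> darts M' = ?D \<and> map_iso \<phi> M M'" if "\<phi> \<in> ?P" for \<phi>
    using ex_transport[OF M permutes_imp_bij] that by blast
  then obtain F where F: "is_map (F \<phi>)" "darts (F \<phi>) = ?D" "map_iso \<phi> M (F \<phi>)" if "\<phi> \<in> ?P" for \<phi>
    by metis
  have F_eq: "F \<phi> = M'" if "\<phi> \<in> ?P" "is_map M'" "darts M' = ?D" "map_iso \<phi> M M'" for \<phi> M'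
    using F[OF that(1)] that by (intro rmap_eqI[of _ _ \<phi> M]) auto
  have "F ` ?P = L"
  proof (intro equalityI subsetI)
    fix M' assume "M' \<in> F ` ?P"
    then show "M' \<in> L" using F unfolding L_def by blast
  next
    fix M' assume "M' \<in> L"
    then obtain \<phi> where M': "is_map M'" "darts M' = ?D" "map_iso \<phi> M M'" by (auto simp: L_def)
    define \<psi> where "\<psi> = perm_restrict \<phi> ?D"
    have "bij_betw \<phi> ?D ?D" using M'(2,3) by (simp add: map_iso_def)
    then have \<psi>: "\<psi> permutes ?D"
      unfolding \<psi>_def using fin by (intro perm_restrict_permutes) (auto simp: bij_betw_def)
    have in_D: "set (roots M) \<subseteq> ?D"
      "\<And>e. e \<in> ?D \<Longrightarrow> \<sigma>0 M e \<in> ?D" "\<And>e. e \<in> ?D \<Longrightarrow> \<sigma>1 M e \<in> ?D" "\<And>e. e \<in> ?D \<Longrightarrow> \<sigma>2 M e \<in> ?D"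
      using M by (auto simp: is_map_def permutes_in_image)
    have eq: "\<psi> e = \<phi> e" if "e \<in> ?D" for e using that by (simp add: \<psi>_def perm_restrict_simps)
    have "map \<psi> (roots M) = map \<phi> (roots M)" using in_D(1) eq by auto
    then have "map_iso \<psi> M M'"
      using M'(2,3) permutes_imp_bij[OF \<psi>] eq in_D by (simp add: map_iso_def del: map_eq_conv)
    then have "F \<psi> = M'" using \<psi> M' by (intro F_eq) auto
    then show "M' \<in> F ` ?P" using \<psi> by blast
  qed
  moreover have "card {\<phi> \<in> ?P. F \<phi> = M'} = card (Aut M)" if "M' \<in> F ` ?P" for M'
  proof -
    from that obtain \<psi> where \<psi>: "\<psi> permutes ?D" "M' = F \<psi>" by blast
    have M': "is_map M'" "darts M' = ?D" "map_iso \<psi> M M'" using F \<psi> by auto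
    have "bij_betw (\<lambda>\<phi>. inv \<psi> \<circ> \<phi>) {\<phi> \<in> ?P. F \<phi> = M'} (Aut M)"
    proof (rule bij_betw_byWitness[where f' = "\<lambda>\<alpha>. \<psi> \<circ> \<alpha>"])
      show "(\<lambda>\<phi>. inv \<psi> \<circ> \<phi>) ` {\<phi> \<in> ?P. F \<phi> = M'} \<subseteq> Aut M"
      proof safe
        fix \<phi> assume \<phi>: "\<phi> permutes ?D" "M' = F \<phi>"
        then have "map_iso \<phi> M M'" using F(3)[of \<phi>] by simp
        then have "map_iso (inv \<psi> \<circ> \<phi>) M M"
          using map_iso_inv_permutes[OF M'(3) M \<psi>(1) M'(2)] by (rule map_iso_comp)
        then show "inv \<psi> \<circ> \<phi> \<in> Aut M"
          using permutes_compose[OF \<phi>(1) permutes_inv[OF \<psi>(1)]] by (simp add: Aut_def)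
      qed
      show "(\<lambda>\<alpha>. \<psi> \<circ> \<alpha>) ` Aut M \<subseteq> {\<phi> \<in> ?P. F \<phi> = M'}"
      proof
        fix \<phi> assume "\<phi> \<in> (\<lambda>\<alpha>. \<psi> \<circ> \<alpha>) ` Aut M"
        then obtain \<alpha> where \<alpha>: "\<alpha> permutes ?D" "map_iso \<alpha> M M" "\<phi> = \<psi> \<circ> \<alpha>" by (auto simp: Aut_def)
        have "\<phi> permutes ?D" unfolding \<alpha>(3) using \<alpha>(1) \<psi>(1) by (rule permutes_compose)
        moreover have "map_iso \<phi> M M'" unfolding \<alpha>(3) using \<alpha>(2) M'(3) by (rule map_iso_comp)
        ultimately show "\<phi> \<in> {\<phi> \<in> ?P. F \<phi> = M'}" using F_eq M' by auto
      qed
    qed (use permutes_inverses[OF \<psi>(1)] in \<open>auto simp: fun_eq_iff\<close>)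
    then show ?thesis by (rule bij_betw_same_card)
  qed
  moreover have "card ?P = (\<Sum>M'\<in>F ` ?P. card {\<phi> \<in> ?P. F \<phi> = M'})"
    using sum.image_gen[of ?P "\<lambda>_. 1 :: nat" F] fin by (simp add: finite_permutations)
  ultimately show ?thesis using card_permutations[OF refl fin] by simp
qed

text \<open>
  The total degree of all faces, hence the number of darts, of the maps that contribute to the
  coefficient with exponents \<open>e\<close>.
\<close>

definition dart_number :: "nat list \<Rightarrow> (nat \<Rightarrow>\<^sub>0 nat) \<Rightarrow> nat" where
  "dart_number \<mu> e = sum_list \<mu> + (\<Sum>k\<in>Poly_Mapping.keys e. k * Poly_Mapping.lookup e k)"

lemma card_darts_eq:
  assumes M: "is_map M" "boundary_degrees M = \<mu>" and e: "\<And>k. face_count M k = Poly_Mapping.lookup e k"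
  shows "card (darts M) = dart_number \<mu> e"
proof -
  have fin: "finite (internal_faces M)"
    using M(1) by (auto simp: internal_faces_def faces_def cycles_on_def is_map_def)
  have "(\<Sum>c\<in>internal_faces M. card c) =
      (\<Sum>k\<in>card ` internal_faces M. \<Sum>c | c \<in> internal_faces M \<and> card c = k. card c)"
    using fin by (rule sum.image_gen)
  also have "\<dots> = (\<Sum>k\<in>card ` internal_faces M. k * face_count M k)"
    by (intro sum.cong refl) (simp add: face_count_def)
  also have "\<dots> = (\<Sum>k\<in>Poly_Mapping.keys e. k * Poly_Mapping.lookup e k)"
  proof (rule sum.mono_neutral_cong_left[symmetric])
    show "Poly_Mapping.keys e \<subseteq> card ` internal_faces M"
    proof
      fix k assume "k \<in> Poly_Mapping.keys e"
      then have "face_count M k \<noteq> 0" using e by (simp add: in_keys_iff)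
      then have "{c \<in> internal_faces M. card c = k} \<noteq> {}"
        unfolding face_count_def by (metis card.empty)
      then show "k \<in> card ` internal_faces M" by auto
    qed
  qed (use fin e in \<open>auto simp: in_keys_iff\<close>)
  finally show ?thesis
    using card_darts[OF M(1)] M(2) by (simp add: dart_number_def)
qed

definition labelled :: "nat rmap set \<Rightarrow> nat \<Rightarrow> (nat \<Rightarrow>\<^sub>0 nat) \<Rightarrow> nat rmap set" where
  "labelled A N e = {M \<in> A. darts M = {..<N} \<and> (\<forall>k. face_count M k = Poly_Mapping.lookup e k)}"

text \<open>
  Each equivalence class with nonzero weight contains \<open>N! / |Aut M|\<close> maps with darts \<open>0, \<dots>, N - 1\<close>.
\<close>

theorem weight_sum_labelled:
  fixes A :: "nat rmap set"
  assumes A: "A \<subseteq> maps_with \<mu>" and closed: "\<And>M M'. M \<in> A \<Longrightarrow> (M, M') \<in> map_equiv \<Longrightarrow> M' \<in> A"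
    and N: "N = dart_number \<mu> e"
  shows "weight_sum A e =
    (\<Sum>M\<in>labelled A N e. Poly_Mapping.single (- euler_char M) (1 / fact N))"
proof -
  let ?L = "labelled A N e" and ?q = "\<lambda>M. map_equiv `` {M}"
  let ?f = "\<lambda>M. Poly_Mapping.single (- euler_char M) (1 / fact N) :: laurent"
  have map: "is_map M" "boundary_degrees M = \<mu>" if "M \<in> A" for M
    using that A by (auto simp: maps_with_def)
  have LA: "M \<in> A" if "M \<in> ?L" for M using that by (simp add: labelled_def)
  have "?L \<subseteq> {M. is_map M \<and> darts M = {..<N} \<and> length (roots M) = length \<mu>}"
    using map(1) map(2)[THEN arg_cong[of _ _ length]]
    by (auto simp: labelled_def boundary_degrees_def)
  then have finL: "finite ?L" by (rule finite_subset) (rule finite_maps_on)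
  have self: "M \<in> ?q M" if "M \<in> A" for M
    using map[OF that] map_iso_id by (auto simp: map_equiv_def)
  have cls: "class_weight (?q M) = map_weight M" if "M \<in> A" for M
    using class_weight_eq[OF quotientI[OF that] self[OF that]] .
  have pos: "card (Aut M) > 0" if "M \<in> A" for M
    using card_labellings[OF map(1)[OF that]] fact_nonzero[of "card (darts M)", where 'a = nat]
    by (metis gr0I mult_0_right)
  have wt: "map_weight M e = Poly_Mapping.single (- euler_char M) (1 / of_nat (card (Aut M)))"
    if "M \<in> ?L" for M
    using that by (simp add: labelled_def map_weight_def)
  have classes: "{C \<in> A // map_equiv. class_weight C e \<noteq> 0} = ?q ` ?L"
  proof (intro equalityI subsetI)
    fix C assume C: "C \<in> {C \<in> A // map_equiv. class_weight C e \<noteq> 0}"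
    then obtain M where M: "M \<in> A" "C = ?q M" by (auto elim: quotientE)
    have "map_weight M e \<noteq> 0" using C cls[OF M(1)] M(2) by simp
    then have fc: "face_count M k = Poly_Mapping.lookup e k" for k
      by (auto simp: map_weight_def split: if_splits)
    have "card (darts M) = card {..<N}" "finite (darts M)"
      using card_darts_eq[OF map[OF M(1)] fc] map(1)[OF M(1)] by (simp_all add: N is_map_def)
    then obtain \<phi> where "bij_betw \<phi> (darts M) {..<N}"
      using finite_same_card_bij by blast
    then obtain M' where M': "is_map M'" "darts M' = {..<N}" "map_iso \<phi> M M'"
      using ex_transport[OF map(1)[OF M(1)]] by blast
    then have eqv: "(M, M') \<in> map_equiv" using map(1)[OF M(1)] by (auto simp: map_equiv_def)
    then have "M' \<in> ?L"
      using closed[OF M(1) eqv] M'(2) fc map_iso_invariants(4)[OF M'(3) map(1)[OF M(1)]]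
      by (simp add: labelled_def)
    moreover have "C = ?q M'" unfolding M(2) using eqv by (rule equiv_class_eq[OF equiv_map_equiv])
    ultimately show "C \<in> ?q ` ?L" by blast
  next
    fix C assume "C \<in> ?q ` ?L"
    then obtain M where M: "M \<in> ?L" "C = ?q M" by blast
    have "map_weight M e \<noteq> 0"
      using wt[OF M(1)] pos[OF LA[OF M(1)]] by (metis divide_eq_0_iff lookup_single_eq lookup_zero of_nat_eq_0_iff less_irrefl zero_neq_one)
    then show "C \<in> {C \<in> A // map_equiv. class_weight C e \<noteq> 0}"
      using LA[OF M(1)] cls M(2) by (simp add: quotientI)
  qed
  have fibre: "(\<Sum>M' | M' \<in> ?L \<and> ?q M' = ?q M. ?f M') = class_weight (?q M) e" if M: "M \<in> ?L" for M
  proof -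
    let ?F = "{M'. M' \<in> ?L \<and> ?q M' = ?q M}"
    have isM: "is_map M" using map(1)[OF LA[OF M]] .
    have D: "darts M = {..<N}" using M by (simp add: labelled_def)
    have F: "?F = {M'. is_map M' \<and> darts M' = darts M \<and> (\<exists>\<phi>. map_iso \<phi> M M')}"
    proof (intro equalityI subsetI)
      fix M' assume M': "M' \<in> ?F"
      then have "M' \<in> ?q M" using self LA by blast
      then show "M' \<in> {M'. is_map M' \<and> darts M' = darts M \<and> (\<exists>\<phi>. map_iso \<phi> M M')}"
        using M' D by (auto simp: map_equiv_def labelled_def)
    next
      fix M' assume "M' \<in> {M'. is_map M' \<and> darts M' = darts M \<and> (\<exists>\<phi>. map_iso \<phi> M M')}"
      then obtain \<phi> where M': "is_map M'" "darts M' = {..<N}" "map_iso \<phi> M M'" using D by auto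
      then have eqv: "(M, M') \<in> map_equiv" using isM by (auto simp: map_equiv_def)
      moreover have "M' \<in> ?L"
        using closed[OF LA[OF M] eqv] M'(2) M map_iso_invariants(4)[OF M'(3) isM]
        by (simp add: labelled_def)
      ultimately show "M' \<in> ?F" using equiv_class_eq[OF equiv_map_equiv eqv] by simp
    qed
    have "euler_char M' = euler_char M" if "M' \<in> ?F" for M'
      using that map_iso_invariants(3)[OF _ isM] unfolding F by blast
    then have "(\<Sum>M'\<in>?F. ?f M') = (\<Sum>M'\<in>?F. ?f M)" by (intro sum.cong) simp_all
    also have "\<dots> = Poly_Mapping.single (- euler_char M) (of_nat (card ?F) * (1 / fact N))"
      by (simp only: sum_constant) (simp only: single_of_nat[symmetric] mult_single add_0_left)
    also have "of_nat (card ?F) * (1 / fact N) = (1 / of_nat (card (Aut M)) :: rat)"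
    proof -
      have FN: "card ?F * card (Aut M) = fact N" using card_labellings[OF isM] unfolding F D by simp
      have "of_nat (card ?F) * of_nat (card (Aut M)) = (fact N :: rat)"
        by (simp only: of_nat_mult[symmetric] FN of_nat_fact)
      then show ?thesis using pos[OF LA[OF M]] by (simp add: field_simps)
    qed
    finally show ?thesis using wt[OF M] cls[OF LA[OF M]] by simp
  qed
  have "(\<Sum>M\<in>?L. ?f M) = (\<Sum>C\<in>?q ` ?L. \<Sum>M | M \<in> ?L \<and> ?q M = C. ?f M)"
    using finL by (rule sum.image_gen)
  also have "\<dots> = (\<Sum>C\<in>?q ` ?L. class_weight C e)"
    using fibre by (intro sum.cong refl) blast
  finally show ?thesis unfolding weight_sum_def classes by simp
qed

section \<open>Forgetting the roots\<close>

text \<open>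
  A map without its roots: of these only the set \<open>bdry\<close> of boundary edges is kept, a union of cycles of the
  face permutation. The set \<open>dessins D e\<close> fixes the darts and the numbers of internal faces.
\<close>

record 'a dessin =
  vertex_perm :: "'a \<Rightarrow> 'a"
  edge_perm :: "'a \<Rightarrow> 'a"
  face_perm :: "'a \<Rightarrow> 'a"
  bdry :: "'a set"

definition dessins :: "'a set \<Rightarrow> (nat \<Rightarrow>\<^sub>0 nat) \<Rightarrow> 'a dessin set" where
  "dessins D e = {u. vertex_perm u permutes D \<and> edge_perm u permutes D \<and> face_perm u permutes D \<and>
     (\<forall>x\<in>D. edge_perm u x \<noteq> x \<and> edge_perm u (edge_perm u x) = x) \<and>
     vertex_perm u \<circ> edge_perm u \<circ> face_perm u = id \<and>
     bdry u \<subseteq> D \<and> face_perm u ` bdry u = bdry u \<and>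
     (\<forall>k. card {c \<in> cycles_on (face_perm u) (D - bdry u). card c = k} = Poly_Mapping.lookup e k)}"

definition bdry_type :: "'a dessin \<Rightarrow> nat multiset" where
  "bdry_type u = cycle_type (face_perm u) (bdry u)"

definition simple :: "'a dessin \<Rightarrow> bool" where
  "simple u \<longleftrightarrow> separates (vertex_perm u) (bdry u)"

definition chi :: "'a set \<Rightarrow> 'a dessin \<Rightarrow> int" where
  "chi D u = int (card (cycles_on (vertex_perm u) D)) - int (card (cycles_on (edge_perm u) D)) +
     int (card (cycles_on (face_perm u) (D - bdry u)))"

definition unroot :: "'a rmap \<Rightarrow> 'a dessin" where
  "unroot M = \<lparr>vertex_perm = \<sigma>0 M, edge_perm = \<sigma>1 M, face_perm = \<sigma>2 M, bdry = boundary_edges M\<rparr>"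

lemma unroot_sel [simp]:
  "vertex_perm (unroot M) = \<sigma>0 M" "edge_perm (unroot M) = \<sigma>1 M" "face_perm (unroot M) = \<sigma>2 M"
  "bdry (unroot M) = boundary_edges M"
  by (simp_all add: unroot_def)

lemma finite_dessins:
  fixes D :: "'a set"
  assumes "finite D"
  shows "finite (dessins D e)"
proof -
  let ?P = "{p. p permutes D}"
  let ?f = "\<lambda>(a, b, c, B). \<lparr>vertex_perm = a, edge_perm = b, face_perm = c, bdry = B\<rparr> :: 'a dessin"
  have "finite (?f ` (?P \<times> ?P \<times> ?P \<times> Pow D))"
    using assms by (intro finite_imageI finite_cartesian_product) (simp_all add: finite_permutations)
  then show ?thesis
  proof (rule rev_finite_subset, intro subsetI)
    fix u :: "'a dessin" assume "u \<in> dessins D e"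
    then show "u \<in> ?f ` (?P \<times> ?P \<times> ?P \<times> Pow D)"
      by (intro image_eqI[of _ _ "(vertex_perm u, edge_perm u, face_perm u, bdry u)"])
        (auto simp: dessins_def)
  qed
qed

lemma boundary_edges_eq: "boundary_edges M = \<Union> (orbit (\<sigma>2 M) ` set (roots M))"
  by (simp add: boundary_edges_def boundary_faces_def cycles_on_def)

context
  fixes M :: "'a rmap"
  assumes M: "is_map M"
begin

lemma map_finite: "finite (darts M)" and map_face_perm: "\<sigma>2 M ` darts M = darts M"
  and map_vertex_perm: "\<sigma>0 M ` darts M = darts M" and map_roots: "set (roots M) \<subseteq> darts M"
  using M by (auto simp: is_map_def permutes_image)

lemma boundary_edges_subset: "boundary_edges M \<subseteq> darts M"
  using orbit_subset_invariant[OF map_face_perm] map_roots by (auto simp: boundary_edges_eq)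

lemma boundary_edges_invariant: "\<sigma>2 M ` boundary_edges M = boundary_edges M"
proof -
  have "inj (\<sigma>2 M)" using M by (auto simp: is_map_def permutes_inj)
  moreover have "\<sigma>2 M ` boundary_edges M \<subseteq> boundary_edges M"
    by (auto simp: boundary_edges_eq intro: orbit.step)
  moreover have "finite (boundary_edges M)"
    using boundary_edges_subset map_finite by (rule finite_subset)
  ultimately show ?thesis by (simp add: endo_inj_surj inj_on_subset)
qed

lemma roots_in_rootings: "roots M \<in> rootings (\<sigma>2 M) (boundary_edges M) (boundary_degrees M)"
proof -
  have "set (roots M) \<subseteq> boundary_edges M"
    using self_in_orbit[OF map_finite map_face_perm] map_roots by (auto simp: boundary_edges_eq)
  moreover have "distinct (map (orbit (\<sigma>2 M)) (roots M))"
    using M by (simp add: is_map_def distinct_conv_nth)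
  ultimately show ?thesis
    by (simp add: rootings_def boundary_degrees_def boundary_edges_eq)
qed

text \<open>
  The right-hand side refers to the roots only through the set of boundary edges, as is needed to forget them.
\<close>

lemma internal_faces_eq: "internal_faces M = cycles_on (\<sigma>2 M) (darts M - boundary_edges M)"
proof (intro equalityI subsetI)
  fix c assume "c \<in> internal_faces M"
  then obtain x where x: "x \<in> darts M" "c = orbit (\<sigma>2 M) x" "c \<notin> orbit (\<sigma>2 M) ` set (roots M)"
    by (auto simp: internal_faces_def faces_def boundary_faces_def cycles_on_def)
  have "x \<notin> boundary_edges M"
    using x(2,3) map_roots orbit_eq[OF map_finite map_face_perm] by (fastforce simp: boundary_edges_eq)
  then show "c \<in> cycles_on (\<sigma>2 M) (darts M - boundary_edges M)" using x by (simp add: cycles_on_def)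
next
  fix c assume "c \<in> cycles_on (\<sigma>2 M) (darts M - boundary_edges M)"
  then obtain x where x: "x \<in> darts M" "c = orbit (\<sigma>2 M) x" "x \<notin> boundary_edges M"
    by (auto simp: cycles_on_def)
  have "x \<in> c" using self_in_orbit[OF map_finite map_face_perm] x by simp
  then have "c \<notin> orbit (\<sigma>2 M) ` set (roots M)" using x(3) by (auto simp: boundary_edges_eq)
  then show "c \<in> internal_faces M"
    using x by (simp add: internal_faces_def faces_def boundary_faces_def cycles_on_def)
qed

lemma chi_unroot: "chi (darts M) (unroot M) = euler_char M"
  by (simp add: chi_def euler_char_def vertices_def edges_def internal_faces_eq)

lemma bdry_type_unroot: "bdry_type (unroot M) = mset (boundary_degrees M)"
  using cycle_type_rooting[OF finite_subset[OF boundary_edges_subset map_finite]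
      boundary_edges_invariant roots_in_rootings]
  by (simp add: bdry_type_def)

lemma simple_unroot: "simple (unroot M) \<longleftrightarrow> fully_simple M"
proof -
  let ?B = "boundary_edges M"
  have B: "b \<in> darts M" if "b \<in> ?B" for b using that boundary_edges_subset by blast
  have self: "b \<in> orbit (\<sigma>0 M) b" if "b \<in> ?B" for b
    using self_in_orbit[OF map_finite map_vertex_perm B[OF that]] .
  have fin: "finite (v \<inter> ?B)" for v
    using finite_subset[OF boundary_edges_subset map_finite] by simp
  show ?thesis
  proof
    assume s: "simple (unroot M)"
    show "fully_simple M"
      unfolding fully_simple_def
    proof
      fix v assume "v \<in> vertices M"
      then obtain x where x: "x \<in> darts M" "v = orbit (\<sigma>0 M) x"
        by (auto simp: vertices_def cycles_on_def)
      have "y = z" if "y \<in> v \<inter> ?B" "z \<in> v \<inter> ?B" for y z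
      proof -
        have "orbit (\<sigma>0 M) y = v"
          using that orbit_eq[OF map_finite map_vertex_perm x(1)] x(2) by blast
        then have "v \<inter> ?B = {y}" using s that by (auto simp: simple_def separates_def)
        then show ?thesis using that by (metis singletonD)
      qed
      then show "card (v \<inter> ?B) \<le> 1" using fin[of v] by (simp add: card_le_Suc0_iff_eq)
    qed
  next
    assume fs: "fully_simple M"
    have "orbit (\<sigma>0 M) b \<inter> ?B = {b}" if b: "b \<in> ?B" for b
    proof -
      have "orbit (\<sigma>0 M) b \<in> vertices M" using B[OF b] by (simp add: vertices_def cycles_on_def)
      then have "card (orbit (\<sigma>0 M) b \<inter> ?B) \<le> Suc 0" using fs by (auto simp: fully_simple_def)
      then show ?thesis using fin self[OF b] b by (auto simp: card_le_Suc0_iff_eq)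
    qed
    then show "simple (unroot M)" by (simp add: simple_def separates_def)
  qed
qed

lemma unroot_in_dessins:
  assumes "\<And>k. face_count M k = Poly_Mapping.lookup e k"
  shows "unroot M \<in> dessins (darts M) e"
  using M assms boundary_edges_subset boundary_edges_invariant
  by (simp add: dessins_def is_map_def face_count_def internal_faces_eq)

end

definition rooted :: "'a set \<Rightarrow> 'a dessin \<Rightarrow> 'a list \<Rightarrow> 'a rmap" where
  "rooted D u R = \<lparr>darts = D, \<sigma>0 = vertex_perm u, \<sigma>1 = edge_perm u, \<sigma>2 = face_perm u, roots = R\<rparr>"

lemma rooted_properties:
  assumes fin: "finite D" and u: "u \<in> dessins D e" and R: "R \<in> rootings (face_perm u) (bdry u) \<mu>"
  defines "M \<equiv> rooted D u R"
  shows "is_map M" "unroot M = u" "boundary_degrees M = \<mu>" "darts M = D" "roots M = R"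
    and "face_count M k = Poly_Mapping.lookup e k"
proof -
  have "set R \<subseteq> D" using R u by (auto simp: rootings_def dessins_def)
  moreover have "distinct (map (orbit (face_perm u)) R)" using R by (simp add: rootings_def)
  ultimately show M: "is_map M"
    using u fin by (auto simp: is_map_def M_def rooted_def dessins_def distinct_conv_nth)
  show unroot: "unroot M = u"
    using R by (simp add: unroot_def boundary_edges_eq M_def rooted_def rootings_def)
  show D: "darts M = D" and "roots M = R" by (simp_all add: M_def rooted_def)
  show "boundary_degrees M = \<mu>"
    using R by (simp add: boundary_degrees_def M_def rooted_def rootings_def)
  have "\<sigma>2 M = face_perm u" "boundary_edges M = bdry u" using unroot by auto
  then show "face_count M k = Poly_Mapping.lookup e k"
    using u D by (simp add: face_count_def internal_faces_eq[OF M] dessins_def)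
qed

text \<open>
  Maps with boundary degrees \<open>\<mu>\<close> are dessins of boundary type \<open>\<mu>\<close> with a rooting of the boundary,
  and \<open>card_rootings\<close> gives the number of rootings. The predicate \<open>P\<close> covers both all maps and
  the fully simple ones.
\<close>

theorem sum_labelled_dessins:
  fixes f :: "int \<Rightarrow> laurent" and P :: "nat dessin \<Rightarrow> bool"
  shows "(\<Sum>M\<in>labelled {M \<in> maps_with \<mu>. P (unroot M)} N e. f (euler_char M)) =
    of_nat (z_partition \<mu>) * (\<Sum>u | u \<in> dessins {..<N} e \<and> bdry_type u = mset \<mu> \<and> P u. f (chi {..<N} u))"
proof -
  let ?D = "{..<N}"
  let ?U = "{u. u \<in> dessins ?D e \<and> bdry_type u = mset \<mu> \<and> P u}"
  let ?L = "labelled {M \<in> maps_with \<mu>. P (unroot M)} N e"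
  let ?R = "\<lambda>u. rootings (face_perm u) (bdry u) \<mu>"
  have L: "is_map M" "boundary_degrees M = \<mu>" "P (unroot M)" "darts M = ?D"
    "\<And>k. face_count M k = Poly_Mapping.lookup e k" if "M \<in> ?L" for M
    using that by (auto simp: labelled_def maps_with_def)
  have B: "finite (bdry u)" "face_perm u ` bdry u = bdry u" if "u \<in> ?U" for u
    using that by (auto simp: dessins_def intro: finite_subset)
  have finU: "finite ?U" using finite_dessins[of ?D e] by simp
  have "(\<Sum>M\<in>?L. f (euler_char M)) = (\<Sum>(u, R)\<in>(SIGMA u : ?U. ?R u). f (chi ?D u))"
  proof (rule sum.reindex_bij_witness[where j = "\<lambda>M. (unroot M, roots M)" and i = "\<lambda>(u, R). rooted ?D u R"])
    fix M assume M: "M \<in> ?L"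
    note M' = L[OF M]
    show "(case (unroot M, roots M) of (u, R) \<Rightarrow> rooted ?D u R) = M"
      using M'(4) by (simp add: rooted_def)
    show "(unroot M, roots M) \<in> (SIGMA u : ?U. ?R u)"
      using unroot_in_dessins[OF M'(1,5)] roots_in_rootings[OF M'(1)] bdry_type_unroot[OF M'(1)] M'(2-4)
      by simp
    show "(case (unroot M, roots M) of (u, R) \<Rightarrow> f (chi ?D u)) = f (euler_char M)"
      using chi_unroot[OF M'(1)] M'(4) by simp
  next
    fix p assume "p \<in> (SIGMA u : ?U. ?R u)"
    then obtain u R where p: "p = (u, R)" "u \<in> ?U" "R \<in> ?R u" by blast
    have "u \<in> dessins ?D e" using p(2) by simp
    note r = rooted_properties[OF finite_lessThan this p(3)]
    show "(unroot (case p of (u, R) \<Rightarrow> rooted ?D u R), roots (case p of (u, R) \<Rightarrow> rooted ?D u R)) = p"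
      using r(2,5) p(1) by simp
    show "(case p of (u, R) \<Rightarrow> rooted ?D u R) \<in> ?L"
      using r p(1,2) by (simp add: labelled_def maps_with_def)
  qed
  also have "\<dots> = (\<Sum>u\<in>?U. \<Sum>R\<in>?R u. f (chi ?D u))"
    using finU finite_rootings[OF B(1)] by (subst sum.Sigma) auto
  also have "\<dots> = (\<Sum>u\<in>?U. of_nat (z_partition \<mu>) * f (chi ?D u))"
    using card_rootings[OF B] by (intro sum.cong) (auto simp: bdry_type_def)
  finally show ?thesis by (simp only: sum_distrib_left)
qed

section \<open>Cutting the vertices at the boundary\<close>

text \<open>
  The factor \<open>inv \<pi>\<close> in the face permutation compensates for \<open>\<pi>\<close> in the vertex permutation, so that the
  product of the three permutations remains the identity.
\<close>

definition reglue :: "'a dessin \<Rightarrow> ('a \<Rightarrow> 'a) \<Rightarrow> 'a dessin" where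
  "reglue u \<pi> = u\<lparr>vertex_perm := \<pi> \<circ> vertex_perm u, face_perm := face_perm u \<circ> inv \<pi>\<rparr>"

definition bdry_return :: "'a dessin \<Rightarrow> 'a \<Rightarrow> 'a" where
  "bdry_return u = perm_restrict (first_return (vertex_perm u) (bdry u)) (bdry u)"

lemma reglue_sel [simp]:
  "vertex_perm (reglue u \<pi>) = \<pi> \<circ> vertex_perm u" "edge_perm (reglue u \<pi>) = edge_perm u"
  "face_perm (reglue u \<pi>) = face_perm u \<circ> inv \<pi>" "bdry (reglue u \<pi>) = bdry u"
  by (simp_all add: reglue_def)

lemma internal_faces_reglue:
  assumes "u \<in> dessins D e" "\<pi> permutes bdry u"
  shows "cycles_on (face_perm u \<circ> inv \<pi>) (D - bdry u) = cycles_on (face_perm u) (D - bdry u)"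
proof (rule cycles_on_cong[symmetric])
  have p: "face_perm u permutes D" "bdry u \<subseteq> D" "face_perm u ` bdry u = bdry u"
    using assms(1) by (auto simp: dessins_def)
  then show "face_perm u ` (D - bdry u) \<subseteq> D - bdry u"
    using inj_image_mem_iff[OF permutes_inj[OF p(1)], of _ "bdry u"] by (auto simp: permutes_in_image)
  show "face_perm u x = (face_perm u \<circ> inv \<pi>) x" if "x \<in> D - bdry u" for x
    using that permutes_inv[OF assms(2)] by (simp add: permutes_not_in)
qed

lemma reglue_in_dessins:
  assumes "u \<in> dessins D e" "\<pi> permutes bdry u"
  shows "reglue u \<pi> \<in> dessins D e"
proof -
  have u: "bdry u \<subseteq> D" "vertex_perm u permutes D" "face_perm u permutes D"
    "face_perm u ` bdry u = bdry u" "vertex_perm u \<circ> edge_perm u \<circ> face_perm u = id"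
    using assms(1) by (auto simp: dessins_def)
  have \<pi>: "\<pi> permutes D" "inv \<pi> permutes D"
    using permutes_subset[OF assms(2) u(1)] permutes_inv by auto
  have "\<pi> \<circ> vertex_perm u permutes D" "face_perm u \<circ> inv \<pi> permutes D"
    using u(2,3) \<pi> permutes_compose by blast+
  moreover have "\<pi> \<circ> vertex_perm u \<circ> edge_perm u \<circ> (face_perm u \<circ> inv \<pi>) = id"
  proof
    fix x
    have "vertex_perm u (edge_perm u (face_perm u y)) = y" for y
      using fun_cong[OF u(5), of y] by simp
    then show "(\<pi> \<circ> vertex_perm u \<circ> edge_perm u \<circ> (face_perm u \<circ> inv \<pi>)) x = id x"
      using permutes_inverses(1)[OF assms(2)] by simp
  qed
  moreover have "(face_perm u \<circ> inv \<pi>) ` bdry u = bdry u"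
    using u(4) permutes_image[OF permutes_inv[OF assms(2)]] by (metis image_comp)
  ultimately show ?thesis
    using assms internal_faces_reglue[OF assms] unfolding dessins_def by simp
qed

lemma chi_reglue:
  assumes "finite D" "u \<in> dessins D e" "simple u" "\<pi> permutes bdry u"
  shows "chi D (reglue u \<pi>) = chi D u - (int (card (bdry u)) - int (card (cycles_on \<pi> (bdry u))))"
proof -
  have "card (cycles_on (\<pi> \<circ> vertex_perm u) D) + card (bdry u) =
      card (cycles_on (vertex_perm u) D) + card (cycles_on \<pi> (bdry u))"
    using assms by (intro card_cycles_comp) (auto simp: dessins_def simple_def)
  then show ?thesis
    using internal_faces_reglue[OF assms(2,4)] by (simp add: chi_def)
qed

lemma bdry_return_reglue:
  assumes "simple u" "\<pi> permutes bdry u"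
  shows "bdry_return (reglue u \<pi>) = \<pi>"
proof
  fix x show "bdry_return (reglue u \<pi>) x = \<pi> x"
  proof (cases "x \<in> bdry u")
    case True
    then show ?thesis
      using first_return_comp[of "vertex_perm u" "bdry u" \<pi> x] assms
      by (simp add: bdry_return_def perm_restrict_simps simple_def)
  qed (use assms(2) in \<open>simp add: bdry_return_def perm_restrict_simps permutes_not_in\<close>)
qed

lemma reglue_reglue:
  assumes "\<pi> permutes B"
  shows "reglue (reglue u \<pi>) (inv \<pi>) = u" "reglue (reglue u (inv \<pi>)) \<pi> = u"
  using permutes_inverses[OF assms] permutes_inv_inv[OF assms]
  by (simp_all add: reglue_def fun_eq_iff)

lemma bdry_return_permutes:
  assumes "finite D" "u \<in> dessins D e"
  shows "bdry_return u permutes bdry u" "simple (reglue u (inv (bdry_return u)))"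
  using separates_first_return[OF assms(1), of "vertex_perm u" "bdry u"] assms(2)
  by (auto simp: dessins_def bdry_return_def simple_def)

text \<open>
  Gluing is a bijection from pairs of a fully simple dessin and a permutation of its boundary onto all
  dessins; the inverse cuts along the first return map.
\<close>

lemma sum_reglue:
  fixes D :: "'a set"
  assumes fin: "finite D"
  shows "(\<Sum>u | u \<in> dessins D e \<and> bdry_type u = mset \<nu>. Poly_Mapping.single (- chi D u) c) =
    (\<Sum>u | u \<in> dessins D e \<and> simple u.
      Poly_Mapping.single (- chi D u) c * reglue_sum (face_perm u) (bdry u) \<nu>)"
proof -
  let ?U = "{u. u \<in> dessins D e \<and> bdry_type u = mset \<nu>}"
  let ?S = "{u. u \<in> dessins D e \<and> simple u}"
  let ?P = "\<lambda>u. {\<pi>. \<pi> permutes bdry u \<and> cycle_type (face_perm u \<circ> inv \<pi>) (bdry u) = mset \<nu>}"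
  let ?f = "\<lambda>u. Poly_Mapping.single (- chi D u) c"
  have finB: "finite (bdry u)" if "u \<in> ?S" for u
    using that fin by (auto simp: dessins_def intro: finite_subset)
  have finS: "finite ?S" using finite_dessins[OF fin] by simp
  have "(\<Sum>u\<in>?U. ?f u) = (\<Sum>(u, \<pi>)\<in>(SIGMA u : ?S. ?P u). ?f (reglue u \<pi>))"
  proof (rule sum.reindex_bij_witness[where i = "\<lambda>(u, \<pi>). reglue u \<pi>" and
        j = "\<lambda>u. (reglue u (inv (bdry_return u)), bdry_return u)"])
    fix u assume u: "u \<in> ?U"
    then have d: "u \<in> dessins D e" by simp
    note b = bdry_return_permutes[OF fin d]
    note restore = reglue_reglue(2)[OF b(1), of u]
    show "(case (reglue u (inv (bdry_return u)), bdry_return u) of (u, \<pi>) \<Rightarrow> reglue u \<pi>) = u"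
      using restore by simp
    show "(reglue u (inv (bdry_return u)), bdry_return u) \<in> (SIGMA u : ?S. ?P u)"
    proof -
      have "face_perm (reglue u (inv (bdry_return u))) \<circ> inv (bdry_return u) = face_perm u"
        using arg_cong[OF restore, of face_perm] by (simp only: reglue_sel(3))
      then show ?thesis
        using u b reglue_in_dessins[OF d permutes_inv[OF b(1)]]
        by (simp add: bdry_type_def del: reglue_sel(3))
    qed
    show "(case (reglue u (inv (bdry_return u)), bdry_return u) of (u, \<pi>) \<Rightarrow> ?f (reglue u \<pi>)) = ?f u"
      using restore by simp
  next
    fix p assume "p \<in> (SIGMA u : ?S. ?P u)"
    then obtain u \<pi> where p: "p = (u, \<pi>)" "u \<in> ?S" "\<pi> \<in> ?P u" by blast
    then have \<pi>: "\<pi> permutes bdry u" by simp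
    show "(reglue (case p of (u, \<pi>) \<Rightarrow> reglue u \<pi>) (inv (bdry_return (case p of (u, \<pi>) \<Rightarrow> reglue u \<pi>))),
        bdry_return (case p of (u, \<pi>) \<Rightarrow> reglue u \<pi>)) = p"
      using bdry_return_reglue[OF _ \<pi>] reglue_reglue(1)[OF \<pi>, of u] p(1,2) by simp
    show "(case p of (u, \<pi>) \<Rightarrow> reglue u \<pi>) \<in> ?U"
      using reglue_in_dessins[OF _ \<pi>] p by (simp add: bdry_type_def)
  qed
  also have "\<dots> = (\<Sum>u\<in>?S. \<Sum>\<pi>\<in>?P u. ?f (reglue u \<pi>))"
    using finS finB by (subst sum.Sigma) (auto simp: finite_permutations)
  also have "\<dots> = (\<Sum>u\<in>?S. ?f u * reglue_sum (face_perm u) (bdry u) \<nu>)"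
  proof (intro sum.cong refl)
    fix u assume "u \<in> ?S"
    then have chi: "chi D (reglue u \<pi>) =
        chi D u - (int (card (bdry u)) - int (card (cycles_on \<pi> (bdry u))))" if "\<pi> \<in> ?P u" for \<pi>
      using chi_reglue[OF fin] that by blast
    show "(\<Sum>\<pi>\<in>?P u. ?f (reglue u \<pi>)) = ?f u * reglue_sum (face_perm u) (bdry u) \<nu>"
      unfolding reglue_sum_def sum_distrib_left
      by (intro sum.cong refl) (simp add: mult_single chi)
  qed
  finally show ?thesis .
qed

lemma bdry_type_partition:
  assumes "finite D" "u \<in> dessins D e"
  obtains \<mu> where "partition_of (card (bdry u)) \<mu>" "mset \<mu> = bdry_type u"
proof -
  have u: "finite (bdry u)" "face_perm u ` bdry u = bdry u"
    using assms by (auto simp: dessins_def intro: finite_subset)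
  let ?\<mu> = "rev (sorted_list_of_multiset (bdry_type u))"
  have \<mu>: "mset ?\<mu> = bdry_type u" by simp
  have "p > 0" if "p \<in> set ?\<mu>" for p
    using cycle_type_pos[OF u, of p] that by (simp add: bdry_type_def)
  moreover have "sorted_wrt (\<ge>) ?\<mu>"
    using sorted_sorted_list_of_multiset[of "bdry_type u"] by (simp add: sorted_wrt_rev)
  moreover have "sum_list ?\<mu> = card (bdry u)"
    using sum_mset_cycle_type[OF u] \<mu> by (metis bdry_type_def sum_mset_sum_list)
  ultimately have "partition_of (card (bdry u)) ?\<mu>" by (simp add: partition_of_def)
  then show thesis using \<mu> by (rule that)
qed

lemma partition_of_mset_eq:
  assumes "partition_of d \<mu>" "partition_of d' \<mu>'" "mset \<mu> = mset \<mu>'"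
  shows "\<mu> = \<mu>'"
proof -
  have "sorted (rev \<mu>)" "sorted (rev \<mu>')"
    using assms(1,2) by (auto simp: partition_of_def sorted_wrt_rev)
  then have "rev \<mu> = rev \<mu>'" using assms(3) by (metis mset_rev properties_for_sort)
  then show ?thesis by simp
qed

lemma reglue_sum_eq_0:
  assumes "finite A" "g ` A = A" "sum_list \<nu> \<noteq> card A"
  shows "reglue_sum g A \<nu> = 0"
proof -
  have "cycle_type (g \<circ> inv \<pi>) A \<noteq> mset \<nu>" if "\<pi> permutes A" for \<pi>
  proof
    assume "cycle_type (g \<circ> inv \<pi>) A = mset \<nu>"
    moreover have "(g \<circ> inv \<pi>) ` A = A"
      using assms(2) permutes_image[OF permutes_inv[OF that]] by (metis image_comp)
    ultimately show False
      using sum_mset_cycle_type[OF assms(1), of "g \<circ> inv \<pi>"] assms(3) by (simp add: sum_mset_sum_list)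
  qed
  then have no: "{\<pi>. \<pi> permutes A \<and> cycle_type (g \<circ> inv \<pi>) A = mset \<nu>} = {}" by blast
  show ?thesis unfolding reglue_sum_def no by simp
qed

text \<open>
  Only the dessins with \<open>d\<close> boundary edges contribute, since gluing preserves their number. They are
  grouped by their boundary type \<open>\<mu>\<close>, which determines the gluing sum by \<open>reglue_sum_hurwitz\<close>.
\<close>

lemma sum_reglue_by_type:
  fixes D :: "'a set"
  assumes fin: "finite D" and \<nu>: "sum_list \<nu> = d"
  shows "(\<Sum>u | u \<in> dessins D e \<and> simple u. F u * reglue_sum (face_perm u) (bdry u) \<nu>) =
    (\<Sum>\<mu> | partition_of d \<mu>. hurwitz_series d \<nu> \<mu> * (of_nat (z_partition \<mu>) *
      (\<Sum>u | u \<in> dessins D e \<and> bdry_type u = mset \<mu> \<and> simple u. F u)))"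
proof -
  let ?S = "{u. u \<in> dessins D e \<and> simple u}"
  let ?T = "\<lambda>\<mu>. {u. u \<in> dessins D e \<and> bdry_type u = mset \<mu> \<and> simple u}"
  let ?G = "\<lambda>u. F u * reglue_sum (face_perm u) (bdry u) \<nu>"
  have u: "finite (bdry u)" "face_perm u ` bdry u = bdry u" if "u \<in> dessins D e" for u
    using that fin by (auto simp: dessins_def intro: finite_subset)
  have finS: "finite ?S" and finT: "finite (?T \<mu>)" for \<mu>
    using finite_dessins[OF fin] by simp_all
  have UT: "u \<in> (\<Union>\<mu>\<in>{\<mu>. partition_of d \<mu>}. ?T \<mu>) \<longleftrightarrow> card (bdry u) = d" if "u \<in> ?S" for u
  proof
    assume "u \<in> (\<Union>\<mu>\<in>{\<mu>. partition_of d \<mu>}. ?T \<mu>)"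
    then obtain \<mu> where "partition_of d \<mu>" "bdry_type u = mset \<mu>" by blast
    then show "card (bdry u) = d"
      using sum_mset_cycle_type[OF u[of u]] that by (simp add: bdry_type_def partition_of_def sum_mset_sum_list)
  next
    assume d: "card (bdry u) = d"
    have "u \<in> dessins D e" using that by simp
    then obtain \<mu> where "partition_of d \<mu>" "mset \<mu> = bdry_type u"
      using bdry_type_partition[OF fin] unfolding d[symmetric] by blast
    then show "u \<in> (\<Union>\<mu>\<in>{\<mu>. partition_of d \<mu>}. ?T \<mu>)" using that by auto
  qed
  have "(\<Sum>u\<in>?S. ?G u) = (\<Sum>u\<in>(\<Union>\<mu>\<in>{\<mu>. partition_of d \<mu>}. ?T \<mu>). ?G u)"
  proof (rule sum.mono_neutral_right[OF finS])
    show "(\<Union>\<mu>\<in>{\<mu>. partition_of d \<mu>}. ?T \<mu>) \<subseteq> ?S" by blast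
    show "\<forall>v\<in>?S - (\<Union>\<mu>\<in>{\<mu>. partition_of d \<mu>}. ?T \<mu>). ?G v = 0"
    proof
      fix v assume v: "v \<in> ?S - (\<Union>\<mu>\<in>{\<mu>. partition_of d \<mu>}. ?T \<mu>)"
      then have "v \<in> dessins D e" "card (bdry v) \<noteq> d" using UT[of v] by auto
      then have "reglue_sum (face_perm v) (bdry v) \<nu> = 0" using \<nu> u by (intro reglue_sum_eq_0) auto
      then show "?G v = 0" by simp
    qed
  qed
  also have "\<dots> = (\<Sum>\<mu> | partition_of d \<mu>. \<Sum>u\<in>?T \<mu>. ?G u)"
    using finT partition_of_mset_eq
    by (intro sum.UNION_disjoint) (auto simp: finite_partitions)
  also have "\<dots> = (\<Sum>\<mu> | partition_of d \<mu>. hurwitz_series d \<nu> \<mu> *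
      (of_nat (z_partition \<mu>) * (\<Sum>u\<in>?T \<mu>. F u)))"
  proof (intro sum.cong refl)
    fix \<mu> assume \<mu>: "\<mu> \<in> {\<mu>. partition_of d \<mu>}"
    have "?G v = hurwitz_series d \<nu> \<mu> * (of_nat (z_partition \<mu>) * F v)" if v: "v \<in> ?T \<mu>" for v
    proof -
      have "v \<in> ?S" "v \<in> (\<Union>\<mu>\<in>{\<mu>. partition_of d \<mu>}. ?T \<mu>)" using v \<mu> by blast+
      then have "card (bdry v) = d" using UT by blast
      then have "reglue_sum (face_perm v) (bdry v) \<nu> = of_nat (z_partition \<mu>) * hurwitz_series d \<nu> \<mu>"
        using reglue_sum_hurwitz[OF u[of v], of \<mu> \<nu>] v by (simp add: bdry_type_def)
      then show ?thesis by (simp only: mult_ac)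
    qed
    then show "(\<Sum>u\<in>?T \<mu>. ?G u) =
        hurwitz_series d \<nu> \<mu> * (of_nat (z_partition \<mu>) * (\<Sum>u\<in>?T \<mu>. F u))"
      unfolding sum_distrib_left by (intro sum.cong refl)
  qed
  finally show ?thesis .
qed

section \<open>Maps and fully simple maps\<close>

lemma maps_with_closed:
  assumes "M \<in> maps_with \<mu>" "(M, M') \<in> map_equiv"
  shows "M' \<in> maps_with \<mu>" "fully_simple M' \<longleftrightarrow> fully_simple M"
proof -
  obtain \<phi> where "is_map M" "is_map M'" "map_iso \<phi> M M'" using assms(2) by (auto simp: map_equiv_def)
  then show "M' \<in> maps_with \<mu>" "fully_simple M' \<longleftrightarrow> fully_simple M"
    using map_iso_invariants(1,2)[of \<phi> M M'] assms(1) by (simp_all add: maps_with_def)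
qed

lemma Map_series_dessins:
  assumes "N = dart_number \<mu> e"
  shows "Map_series \<mu> e = of_nat (z_partition \<mu>) *
    (\<Sum>u | u \<in> dessins {..<N} e \<and> bdry_type u = mset \<mu>.
      Poly_Mapping.single (- chi {..<N} u) (1 / fact N))"
proof -
  have "Map_series \<mu> e =
      (\<Sum>M\<in>labelled (maps_with \<mu>) N e. Poly_Mapping.single (- euler_char M) (1 / fact N))"
    unfolding Map_series_def using maps_with_closed(1) assms
    by (intro weight_sum_labelled[where \<mu> = \<mu>]) auto
  then show ?thesis
    using sum_labelled_dessins[where P = "\<lambda>_. True" and f = "\<lambda>j. Poly_Mapping.single (- j) (1 / fact N)"]
    by simp
qed

lemma FSMap_series_dessins:
  assumes "N = dart_number \<mu> e"
  shows "FSMap_series \<mu> e = of_nat (z_partition \<mu>) *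
    (\<Sum>u | u \<in> dessins {..<N} e \<and> bdry_type u = mset \<mu> \<and> simple u.
      Poly_Mapping.single (- chi {..<N} u) (1 / fact N))"
proof -
  have "FSMap_series \<mu> e = (\<Sum>M\<in>labelled {M \<in> maps_with \<mu>. fully_simple M} N e.
      Poly_Mapping.single (- euler_char M) (1 / fact N))"
    unfolding FSMap_series_def using maps_with_closed assms
    by (intro weight_sum_labelled[where \<mu> = \<mu>]) auto
  also have "{M \<in> maps_with \<mu>. fully_simple M} = {M \<in> maps_with \<mu>. simple (unroot M)}"
    using simple_unroot by (auto simp: maps_with_def)
  finally show ?thesis
    using sum_labelled_dessins[where P = simple and f = "\<lambda>j. Poly_Mapping.single (- j) (1 / fact N)"]
    by simp
qed

theorem theorem1p5:
  fixes d :: nat and \<nu> :: "nat list"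
  assumes "d > 0" and "partition_of d \<nu>"
  shows "Map_series \<nu> =
    (\<lambda>e. of_nat (z_partition \<nu>) *
      (\<Sum>\<mu> | partition_of d \<mu>. hurwitz_series d \<nu> \<mu> * FSMap_series \<mu> e))"
proof
  fix e
  define N where "N = dart_number \<nu> e"
  have N: "N = dart_number \<mu> e" if "partition_of d \<mu>" for \<mu>
    using that assms(2) by (simp add: N_def dart_number_def partition_of_def)
  let ?w = "\<lambda>u. Poly_Mapping.single (- chi {..<N} u) (1 / fact N) :: laurent"
  have "Map_series \<nu> e = of_nat (z_partition \<nu>) *
      (\<Sum>u | u \<in> dessins {..<N} e \<and> bdry_type u = mset \<nu>. ?w u)"
    by (rule Map_series_dessins) (rule N_def)
  also have "(\<Sum>u | u \<in> dessins {..<N} e \<and> bdry_type u = mset \<nu>. ?w u) =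
      (\<Sum>u | u \<in> dessins {..<N} e \<and> simple u. ?w u * reglue_sum (face_perm u) (bdry u) \<nu>)"
    by (rule sum_reglue) simp
  also have "\<dots> = (\<Sum>\<mu> | partition_of d \<mu>. hurwitz_series d \<nu> \<mu> * (of_nat (z_partition \<mu>) *
      (\<Sum>u | u \<in> dessins {..<N} e \<and> bdry_type u = mset \<mu> \<and> simple u. ?w u)))"
    using assms(2) by (intro sum_reglue_by_type) (simp_all add: partition_of_def)
  also have "\<dots> = (\<Sum>\<mu> | partition_of d \<mu>. hurwitz_series d \<nu> \<mu> * FSMap_series \<mu> e)"
    using FSMap_series_dessins N by (intro sum.cong refl) simp
  finally show "Map_series \<nu> e = of_nat (z_partition \<nu>) *
      (\<Sum>\<mu> | partition_of d \<mu>. hurwitz_series d \<nu> \<mu> * FSMap_series \<mu> e)" .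
qed

end
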